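(* There exist a simply connected real Lie group $G$, a cocompact lattice $\Gamma<G$, and an affine automorphism $A\colon\Gamma\backslash G\to\Gamma\backslash G$ such that $A$ is ergodic but not weakly mixing with respect to the Haar measure $m$ on $\Gamma\backslash G$, and such that the set $\mathcal J_{\Gamma\backslash G}(A)$ of $A$-invariant complex structures on $\Gamma\backslash G$ contains a complex structure that is not left-invariant.
   Context: Affine automorphism: a diffeomorphism $A$ of $\Gamma\backslash G$ induced by a map of the form $g\mapsto g_0\Phi(g)$ of $G$, where $g_0\in G$ and $\Phi$ is a Lie group automorphism of $G$ (the linear part) with $g_0\Phi(\Gamma)g_0^{-1}=\Gamma$. The Haar measure $m$ is the $G$-invariant probability measure on $\Gamma\backslash G$. A complex structure on a smooth manifold $M$ is a smooth bundle endomorphism $J$ of $TM$ with $J^2=-\operatorname{Id}$ that is integrable, i.e. induced by a complex manifold structure on $M$. It is $A$-invariant if $DA_x\circ J_x=J_{A(x)}\circ DA_x$ for all $x$. Let $\mathfrak g$ be the Lie algebra of $G$. A complex structure on $\Gamma\backslash G$ is left-invariant if it is represented by a constant element of $\operatorname{End}(\mathfrak g)$ in the trivialization $T(\Gamma\backslash G)\cong(\Gamma\backslash G)\times\mathfrak g$ given by left-invariant vector fields on $G$ (which descend to $\Gamma\backslash G$). *)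

theory Defs
  imports "HOL-Probability.Probability" "HOL-Algebra.Coset"
begin

section \<open>Smooth maps between open subsets of Euclidean spaces\<close>

text \<open>
  The dimension has to be a term, so \<open>\<real>\<^sup>n\<close> is the library's \<^const>\<open>Euclidean_space\<close>: the
  sequences \<^typ>\<open>nat \<Rightarrow> real\<close> vanishing from index \<open>n\<close> on. On these, the type-class topology of
  \<^typ>\<open>nat \<Rightarrow> real\<close> (used by \<^const>\<open>continuous_on\<close>) induces the usual one.
\<close>

definition partial_deriv :: "nat \<Rightarrow> ((nat \<Rightarrow> real) \<Rightarrow> real) \<Rightarrow> (nat \<Rightarrow> real) \<Rightarrow> real" where
  "partial_deriv i f x = deriv (\<lambda>t. f (x(i := t))) (x i)"

fun iterated_partial_deriv :: "nat list \<Rightarrow> ((nat \<Rightarrow> real) \<Rightarrow> real) \<Rightarrow> (nat \<Rightarrow> real) \<Rightarrow> real" where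
  "iterated_partial_deriv [] f = f"
| "iterated_partial_deriv (i # is) f = partial_deriv i (iterated_partial_deriv is f)"

text \<open>
  \<open>C\<^sup>\<infinity>\<close> on an open subset \<open>U\<close> of \<open>\<real>\<^sup>n\<close>: all iterated partial derivatives exist and are
  continuous. The values of \<open>f\<close> outside \<open>U\<close> do not matter.
\<close>

definition smooth_fun_on :: "nat \<Rightarrow> (nat \<Rightarrow> real) set \<Rightarrow> ((nat \<Rightarrow> real) \<Rightarrow> real) \<Rightarrow> bool" where
  "smooth_fun_on n U f \<longleftrightarrow>
     (\<forall>is. set is \<subseteq> {..<n} \<longrightarrow>
        continuous_on U (iterated_partial_deriv is f) \<and>
        (\<forall>i<n. \<forall>x\<in>U. (\<lambda>t. iterated_partial_deriv is f (x(i := t))) differentiable (at (x i))))"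

definition smooth_on :: "nat \<Rightarrow> nat \<Rightarrow> (nat \<Rightarrow> real) set \<Rightarrow> ((nat \<Rightarrow> real) \<Rightarrow> nat \<Rightarrow> real) \<Rightarrow> bool" where
  "smooth_on n m U f \<longleftrightarrow> (\<forall>j<m. smooth_fun_on n U (\<lambda>x. f x j))"

definition jacobian_map ::
  "nat \<Rightarrow> ((nat \<Rightarrow> real) \<Rightarrow> nat \<Rightarrow> real) \<Rightarrow> (nat \<Rightarrow> real) \<Rightarrow> (nat \<Rightarrow> real) \<Rightarrow> nat \<Rightarrow> real" where
  "jacobian_map n f x u = (\<lambda>i. \<Sum>j<n. partial_deriv j (\<lambda>y. f y i) x * u j)"


section \<open>Smooth manifolds\<close>

text \<open>A chart is a pair of a domain and a coordinate map; the latter is arbitrary off the domain.\<close>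

type_synonym 'a chart = "'a set \<times> ('a \<Rightarrow> nat \<Rightarrow> real)"

record 'a mfd =
  mtop :: "'a topology"
  mdim :: nat
  atlas :: "'a chart set"

definition chart_inv :: "'a chart \<Rightarrow> (nat \<Rightarrow> real) \<Rightarrow> 'a" where
  "chart_inv c = inv_into (fst c) (snd c)"

definition topological_manifold :: "'a mfd \<Rightarrow> bool" where
  "topological_manifold M \<longleftrightarrow>
     Hausdorff_space (mtop M) \<and> second_countable (mtop M) \<and>
     (\<Union>(fst ` atlas M)) = topspace (mtop M) \<and>
     (\<forall>(U, \<phi>) \<in> atlas M.
        openin (mtop M) U \<and> openin (Euclidean_space (mdim M)) (\<phi> ` U) \<and>
        homeomorphic_map (subtopology (mtop M) U)
          (subtopology (Euclidean_space (mdim M)) (\<phi> ` U)) \<phi>)"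

definition smooth_manifold :: "'a mfd \<Rightarrow> bool" where
  "smooth_manifold M \<longleftrightarrow> topological_manifold M \<and>
     (\<forall>c\<in>atlas M. \<forall>d\<in>atlas M.
        smooth_on (mdim M) (mdim M) (snd c ` (fst c \<inter> fst d)) (snd d \<circ> chart_inv c))"

definition smooth_map :: "'a mfd \<Rightarrow> 'b mfd \<Rightarrow> ('a \<Rightarrow> 'b) \<Rightarrow> bool" where
  "smooth_map M N f \<longleftrightarrow> continuous_map (mtop M) (mtop N) f \<and>
     (\<forall>c\<in>atlas M. \<forall>d\<in>atlas N.
        smooth_on (mdim M) (mdim N) (snd c ` (fst c \<inter> f -` fst d)) (snd d \<circ> f \<circ> chart_inv c))"

definition diffeomorphism :: "'a mfd \<Rightarrow> 'b mfd \<Rightarrow> ('a \<Rightarrow> 'b) \<Rightarrow> bool" where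
  "diffeomorphism M N f \<longleftrightarrow>
     bij_betw f (topspace (mtop M)) (topspace (mtop N)) \<and>
     smooth_map M N f \<and> smooth_map N M (inv_into (topspace (mtop M)) f)"

definition join_coords :: "nat \<Rightarrow> (nat \<Rightarrow> real) \<Rightarrow> (nat \<Rightarrow> real) \<Rightarrow> nat \<Rightarrow> real" where
  "join_coords n x y = (\<lambda>i. if i < n then x i else y (i - n))"

definition prod_manifold :: "'a mfd \<Rightarrow> 'b mfd \<Rightarrow> ('a \<times> 'b) mfd" where
  "prod_manifold M N =
     \<lparr>mtop = prod_topology (mtop M) (mtop N), mdim = mdim M + mdim N,
      atlas = {(U \<times> V, \<lambda>(p, q). join_coords (mdim M) (\<phi> p) (\<psi> q)) | U \<phi> V \<psi>.
                 (U, \<phi>) \<in> atlas M \<and> (V, \<psi>) \<in> atlas N}\<rparr>"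

text \<open>
  Paths are maps of topological spaces on the unit interval; the homotopies are relative to the
  end points.
\<close>

definition simply_connected_space :: "'a topology \<Rightarrow> bool" where
  "simply_connected_space X \<longleftrightarrow> path_connected_space X \<and>
     (\<forall>p. pathin X p \<and> p 0 = p 1 \<longrightarrow>
        homotopic_with (\<lambda>q. q 0 = p 0 \<and> q 1 = p 0) (top_of_set {0..1}) X p (\<lambda>_. p 0))"


section \<open>Tangent spaces and tangent maps\<close>

text \<open>
  A tangent vector at \<open>p\<close> is the family of its coordinate vectors in all charts around \<open>p\<close>, related
  by the Jacobians of the chart transitions. It is set to zero at all other charts, which makes the
  family unique and lets the vector space operations be pointwise.
\<close>

type_synonym 'a tvec = "'a chart \<Rightarrow> nat \<Rightarrow> real"

definition charts_at :: "'a mfd \<Rightarrow> 'a \<Rightarrow> 'a chart set" where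
  "charts_at M p = {c \<in> atlas M. p \<in> fst c}"

definition tangent_space :: "'a mfd \<Rightarrow> 'a \<Rightarrow> 'a tvec set" where
  "tangent_space M p =
     {v. (\<forall>c\<in>charts_at M p. v c \<in> topspace (Euclidean_space (mdim M))) \<and>
         (\<forall>c\<in>charts_at M p. \<forall>d\<in>charts_at M p.
            v d = jacobian_map (mdim M) (snd d \<circ> chart_inv c) (snd c p) (v c)) \<and>
         (\<forall>c. c \<notin> charts_at M p \<longrightarrow> v c = (\<lambda>_. 0))}"

definition lin_comb :: "real \<Rightarrow> 'a tvec \<Rightarrow> real \<Rightarrow> 'a tvec \<Rightarrow> 'a tvec" where
  "lin_comb a v b w = (\<lambda>c i. a * v c i + b * w c i)"

definition linear_endo :: "'a tvec set \<Rightarrow> ('a tvec \<Rightarrow> 'a tvec) \<Rightarrow> bool" where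
  "linear_endo T j \<longleftrightarrow> (\<forall>v\<in>T. j v \<in> T) \<and>
     (\<forall>v\<in>T. \<forall>w\<in>T. \<forall>a b. j (lin_comb a v b w) = lin_comb a (j v) b (j w))"

definition tvec_of_coords :: "'a mfd \<Rightarrow> 'a \<Rightarrow> 'a chart \<Rightarrow> (nat \<Rightarrow> real) \<Rightarrow> 'a tvec" where
  "tvec_of_coords M p c u =
     (\<lambda>d. if d \<in> charts_at M p
          then jacobian_map (mdim M) (snd d \<circ> chart_inv c) (snd c p) u else (\<lambda>_. 0))"

definition coord_field :: "'a mfd \<Rightarrow> 'a chart \<Rightarrow> nat \<Rightarrow> 'a \<Rightarrow> 'a tvec" where
  "coord_field M c j p = tvec_of_coords M p c (\<lambda>i. if i = j then 1 else 0)"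

text \<open>
  The differential at \<open>p\<close> of a smooth map \<open>f\<close>. By the chain rule the result does not depend on the
  chart \<open>c\<close> around \<open>p\<close> that is chosen.
\<close>

definition tangent_map :: "'a mfd \<Rightarrow> 'b mfd \<Rightarrow> ('a \<Rightarrow> 'b) \<Rightarrow> 'a \<Rightarrow> 'a tvec \<Rightarrow> 'b tvec" where
  "tangent_map M N f p v =
     (let c = (SOME c. c \<in> charts_at M p) in
      (\<lambda>d. if d \<in> charts_at N (f p)
           then jacobian_map (mdim M) (snd d \<circ> f \<circ> chart_inv c) (snd c p) (v c) else (\<lambda>_. 0)))"

text \<open>
  Bundle endomorphisms of \<open>TM\<close> that are smooth, i.e. whose matrix entries in every chart are
  smooth functions of the coordinates.
\<close>

definition smooth_bundle_endo :: "'a mfd \<Rightarrow> ('a \<Rightarrow> 'a tvec \<Rightarrow> 'a tvec) \<Rightarrow> bool" where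
  "smooth_bundle_endo M J \<longleftrightarrow>
     (\<forall>p\<in>topspace (mtop M). linear_endo (tangent_space M p) (J p)) \<and>
     (\<forall>c\<in>atlas M. \<forall>i<mdim M. \<forall>j<mdim M.
        smooth_fun_on (mdim M) (snd c ` fst c)
          (\<lambda>x. J (chart_inv c x) (coord_field M c j (chart_inv c x)) c i))"


section \<open>Complex structures\<close>

text \<open>
  \<open>\<complex>\<^sup>k\<close> is identified with \<open>\<real>\<^sup>2\<^sup>k\<close> through the real coordinates \<open>(Re z\<^sub>0, Im z\<^sub>0, Re z\<^sub>1, Im z\<^sub>1, \<dots>)\<close>.
\<close>

definition realify :: "(nat \<Rightarrow> complex) \<Rightarrow> nat \<Rightarrow> real" where
  "realify z = (\<lambda>i. if even i then Re (z (i div 2)) else Im (z (i div 2)))"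

definition complexify :: "(nat \<Rightarrow> real) \<Rightarrow> nat \<Rightarrow> complex" where
  "complexify x = (\<lambda>k. Complex (x (2 * k)) (x (2 * k + 1)))"

definition mult_i :: "(nat \<Rightarrow> real) \<Rightarrow> nat \<Rightarrow> real" where
  "mult_i x = realify (\<lambda>k. \<i> * complexify x k)"

definition holomorphic_map_on ::
  "nat \<Rightarrow> nat \<Rightarrow> (nat \<Rightarrow> complex) set \<Rightarrow> ((nat \<Rightarrow> complex) \<Rightarrow> nat \<Rightarrow> complex) \<Rightarrow> bool" where
  "holomorphic_map_on n m U f \<longleftrightarrow>
     (\<forall>j<m. continuous_on U (\<lambda>z. f z j) \<and>
        (\<forall>z\<in>U. \<forall>i<n. (\<lambda>t. f (z(i := t)) j) field_differentiable (at (z i))))"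

definition underlying_manifold ::
  "'a topology \<Rightarrow> nat \<Rightarrow> ('a set \<times> ('a \<Rightarrow> nat \<Rightarrow> complex)) set \<Rightarrow> 'a mfd" where
  "underlying_manifold X k \<C> =
     \<lparr>mtop = X, mdim = 2 * k, atlas = (\<lambda>(V, \<psi>). (V, realify \<circ> \<psi>)) ` \<C>\<rparr>"

definition complex_manifold ::
  "'a topology \<Rightarrow> nat \<Rightarrow> ('a set \<times> ('a \<Rightarrow> nat \<Rightarrow> complex)) set \<Rightarrow> bool" where
  "complex_manifold X k \<C> \<longleftrightarrow> topological_manifold (underlying_manifold X k \<C>) \<and>
     (\<forall>(V, \<psi>) \<in> \<C>. \<forall>(W, \<eta>) \<in> \<C>.
        holomorphic_map_on k k (\<psi> ` (V \<inter> W)) (\<eta> \<circ> inv_into V \<psi>))"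

text \<open>
  \<open>J\<close> is induced by a complex manifold structure on \<open>M\<close>, i.e. by one whose underlying smooth
  structure is that of \<open>M\<close>: under the identity map, \<open>J\<close> becomes multiplication by \<open>\<i>\<close> in the
  holomorphic charts.
\<close>

definition integrable_structure :: "'a mfd \<Rightarrow> ('a \<Rightarrow> 'a tvec \<Rightarrow> 'a tvec) \<Rightarrow> bool" where
  "integrable_structure M J \<longleftrightarrow>
     (\<exists>k \<C>. complex_manifold (mtop M) k \<C> \<and>
        diffeomorphism M (underlying_manifold (mtop M) k \<C>) (\<lambda>p. p) \<and>
        (\<forall>p\<in>topspace (mtop M). \<forall>v\<in>tangent_space M p.
           tangent_map M (underlying_manifold (mtop M) k \<C>) (\<lambda>p. p) p (J p v) =
           (\<lambda>d. mult_i (tangent_map M (underlying_manifold (mtop M) k \<C>) (\<lambda>p. p) p v d))))"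

definition complex_structure :: "'a mfd \<Rightarrow> ('a \<Rightarrow> 'a tvec \<Rightarrow> 'a tvec) \<Rightarrow> bool" where
  "complex_structure M J \<longleftrightarrow> smooth_bundle_endo M J \<and>
     (\<forall>p\<in>topspace (mtop M). \<forall>v\<in>tangent_space M p. J p (J p v) = (\<lambda>c i. - v c i)) \<and>
     integrable_structure M J"

definition invariant_complex_structures ::
  "'a mfd \<Rightarrow> ('a \<Rightarrow> 'a) \<Rightarrow> ('a \<Rightarrow> 'a tvec \<Rightarrow> 'a tvec) set" where
  "invariant_complex_structures M A =
     {J. complex_structure M J \<and>
         (\<forall>p\<in>topspace (mtop M). \<forall>v\<in>tangent_space M p.
            tangent_map M M A p (J p v) = J (A p) (tangent_map M M A p v))}"


section \<open>Lie groups and their compact quotients\<close>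

text \<open>
  A statement that a connected Lie group with some property exists can be made with carriers in the
  type \<^typ>\<open>nat \<Rightarrow> real\<close> without loss of generality, since a connected Lie group has at most
  continuum many elements; this does not restrict \<^const>\<open>mdim\<close>.
\<close>

definition lie_group :: "'a monoid \<Rightarrow> 'a mfd \<Rightarrow> bool" where
  "lie_group G M \<longleftrightarrow> group G \<and> smooth_manifold M \<and> topspace (mtop M) = carrier G \<and>
     smooth_map (prod_manifold M M) M (\<lambda>(x, y). x \<otimes>\<^bsub>G\<^esub> y) \<and> smooth_map M M (\<lambda>x. inv\<^bsub>G\<^esub> x)"

text \<open>
  The quotient \<open>\<Gamma>\G\<close> is the set \<open>rcosets\<^bsub>G\<^esub> \<Gamma>\<close> of the cosets \<open>\<Gamma>g\<close>, with the quotient topology. For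
  discrete \<open>\<Gamma>\<close> its charts are obtained from charts of \<open>G\<close> by means of local inverses of the projection.
\<close>

definition quotient_top :: "'a monoid \<Rightarrow> 'a topology \<Rightarrow> 'a set \<Rightarrow> 'a set topology" where
  "quotient_top G X \<Gamma> =
     topology (\<lambda>W. W \<subseteq> rcosets\<^bsub>G\<^esub> \<Gamma> \<and> openin X {g \<in> topspace X. \<Gamma> #>\<^bsub>G\<^esub> g \<in> W})"

lemma openin_quotient_top:
  "openin (quotient_top G X \<Gamma>) W \<longleftrightarrow>
     W \<subseteq> rcosets\<^bsub>G\<^esub> \<Gamma> \<and> openin X {g \<in> topspace X. \<Gamma> #>\<^bsub>G\<^esub> g \<in> W}"
proof -
  have "istopology (\<lambda>W. W \<subseteq> rcosets\<^bsub>G\<^esub> \<Gamma> \<and> openin X {g \<in> topspace X. \<Gamma> #>\<^bsub>G\<^esub> g \<in> W})"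
    unfolding istopology_def
  proof (intro conjI allI impI)
    fix S T
    assume S: "S \<subseteq> rcosets\<^bsub>G\<^esub> \<Gamma> \<and> openin X {g \<in> topspace X. \<Gamma> #>\<^bsub>G\<^esub> g \<in> S}"
      and T: "T \<subseteq> rcosets\<^bsub>G\<^esub> \<Gamma> \<and> openin X {g \<in> topspace X. \<Gamma> #>\<^bsub>G\<^esub> g \<in> T}"
    show "S \<inter> T \<subseteq> rcosets\<^bsub>G\<^esub> \<Gamma>" using S by blast
    have "{g \<in> topspace X. \<Gamma> #>\<^bsub>G\<^esub> g \<in> S \<inter> T} =
      {g \<in> topspace X. \<Gamma> #>\<^bsub>G\<^esub> g \<in> S} \<inter> {g \<in> topspace X. \<Gamma> #>\<^bsub>G\<^esub> g \<in> T}" by blast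
    then show "openin X {g \<in> topspace X. \<Gamma> #>\<^bsub>G\<^esub> g \<in> S \<inter> T}" using S T by auto
  next
    fix K
    assume K: "\<forall>W\<in>K. W \<subseteq> rcosets\<^bsub>G\<^esub> \<Gamma> \<and> openin X {g \<in> topspace X. \<Gamma> #>\<^bsub>G\<^esub> g \<in> W}"
    show "\<Union>K \<subseteq> rcosets\<^bsub>G\<^esub> \<Gamma>" using K by blast
    have "{g \<in> topspace X. \<Gamma> #>\<^bsub>G\<^esub> g \<in> \<Union>K} =
      (\<Union>W\<in>K. {g \<in> topspace X. \<Gamma> #>\<^bsub>G\<^esub> g \<in> W})" by blast
    then show "openin X {g \<in> topspace X. \<Gamma> #>\<^bsub>G\<^esub> g \<in> \<Union>K}" using K by auto
  qed
  then show ?thesis by (simp add: quotient_top_def)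
qed

definition quotient_manifold :: "'a monoid \<Rightarrow> 'a mfd \<Rightarrow> 'a set \<Rightarrow> 'a set mfd" where
  "quotient_manifold G M \<Gamma> =
     \<lparr>mtop = quotient_top G (mtop M) \<Gamma>, mdim = mdim M,
      atlas = {((\<lambda>g. \<Gamma> #>\<^bsub>G\<^esub> g) ` U, \<phi> \<circ> inv_into U (\<lambda>g. \<Gamma> #>\<^bsub>G\<^esub> g)) | U U' \<phi>.
                 (U', \<phi>) \<in> atlas M \<and> U \<subseteq> U' \<and> openin (mtop M) U \<and> inj_on (\<lambda>g. \<Gamma> #>\<^bsub>G\<^esub> g) U}\<rparr>"

definition preserves_measure :: "'a measure \<Rightarrow> ('a \<Rightarrow> 'a) \<Rightarrow> bool" where
  "preserves_measure m f \<longleftrightarrow> f \<in> measurable m m \<and> distr m m f = m"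

text \<open>
  The \<open>G\<close>-invariant Borel probability measure on \<open>\<Gamma>\G\<close>, where \<open>G\<close> acts by right translations. It is
  unique if it exists.
\<close>

definition haar_measure :: "'a monoid \<Rightarrow> 'a mfd \<Rightarrow> 'a set \<Rightarrow> 'a set measure \<Rightarrow> bool" where
  "haar_measure G M \<Gamma> m \<longleftrightarrow> prob_space m \<and>
     space m = rcosets\<^bsub>G\<^esub> \<Gamma> \<and>
     sets m = sigma_sets (rcosets\<^bsub>G\<^esub> \<Gamma>) {W. openin (mtop (quotient_manifold G M \<Gamma>)) W} \<and>
     (\<forall>g\<in>carrier G. preserves_measure m (\<lambda>q. q #>\<^bsub>G\<^esub> g))"

definition lattice_subgroup :: "'a monoid \<Rightarrow> 'a mfd \<Rightarrow> 'a set \<Rightarrow> bool" where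
  "lattice_subgroup G M \<Gamma> \<longleftrightarrow> subgroup \<Gamma> G \<and> subtopology (mtop M) \<Gamma> = discrete_topology \<Gamma> \<and>
     (\<exists>m. haar_measure G M \<Gamma> m)"

definition cocompact_lattice :: "'a monoid \<Rightarrow> 'a mfd \<Rightarrow> 'a set \<Rightarrow> bool" where
  "cocompact_lattice G M \<Gamma> \<longleftrightarrow>
     lattice_subgroup G M \<Gamma> \<and> compact_space (mtop (quotient_manifold G M \<Gamma>))"

definition lie_group_automorphism :: "'a monoid \<Rightarrow> 'a mfd \<Rightarrow> ('a \<Rightarrow> 'a) \<Rightarrow> bool" where
  "lie_group_automorphism G M \<Phi> \<longleftrightarrow> \<Phi> \<in> iso G G \<and> diffeomorphism M M \<Phi>"

definition affine_automorphism :: "'a monoid \<Rightarrow> 'a mfd \<Rightarrow> 'a set \<Rightarrow> ('a set \<Rightarrow> 'a set) \<Rightarrow> bool" where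
  "affine_automorphism G M \<Gamma> A \<longleftrightarrow>
     diffeomorphism (quotient_manifold G M \<Gamma>) (quotient_manifold G M \<Gamma>) A \<and>
     (\<exists>g\<^sub>0\<in>carrier G. \<exists>\<Phi>. lie_group_automorphism G M \<Phi> \<and>
        (\<lambda>\<gamma>. g\<^sub>0 \<otimes>\<^bsub>G\<^esub> \<Phi> \<gamma> \<otimes>\<^bsub>G\<^esub> inv\<^bsub>G\<^esub> g\<^sub>0) ` \<Gamma> = \<Gamma> \<and>
        (\<forall>g\<in>carrier G. A (\<Gamma> #>\<^bsub>G\<^esub> g) = \<Gamma> #>\<^bsub>G\<^esub> (g\<^sub>0 \<otimes>\<^bsub>G\<^esub> \<Phi> g)))"

text \<open>
  The Lie algebra is the tangent space at the identity; \<open>v\<close> in it gives the left-invariant vector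
  field \<open>left_invariant_field G M v\<close> on \<open>G\<close>, whose image under the projection at \<open>g\<close> depends only
  on the coset of \<open>g\<close>.
\<close>

definition left_invariant_field :: "'a monoid \<Rightarrow> 'a mfd \<Rightarrow> 'a tvec \<Rightarrow> 'a \<Rightarrow> 'a tvec" where
  "left_invariant_field G M v g = tangent_map M M (\<lambda>x. g \<otimes>\<^bsub>G\<^esub> x) \<one>\<^bsub>G\<^esub> v"

definition descended_field :: "'a monoid \<Rightarrow> 'a mfd \<Rightarrow> 'a set \<Rightarrow> 'a tvec \<Rightarrow> 'a \<Rightarrow> 'a set tvec" where
  "descended_field G M \<Gamma> v g =
     tangent_map M (quotient_manifold G M \<Gamma>) (\<lambda>x. \<Gamma> #>\<^bsub>G\<^esub> x) g (left_invariant_field G M v g)"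

definition left_invariant_structure ::
  "'a monoid \<Rightarrow> 'a mfd \<Rightarrow> 'a set \<Rightarrow> ('a set \<Rightarrow> 'a set tvec \<Rightarrow> 'a set tvec) \<Rightarrow> bool" where
  "left_invariant_structure G M \<Gamma> J \<longleftrightarrow>
     (\<exists>j. linear_endo (tangent_space M \<one>\<^bsub>G\<^esub>) j \<and>
        (\<forall>g\<in>carrier G. \<forall>v\<in>tangent_space M \<one>\<^bsub>G\<^esub>.
           J (\<Gamma> #>\<^bsub>G\<^esub> g) (descended_field G M \<Gamma> v g) = descended_field G M \<Gamma> (j v) g))"


section \<open>Ergodicity and weak mixing\<close>

definition ergodic :: "'a measure \<Rightarrow> ('a \<Rightarrow> 'a) \<Rightarrow> bool" where
  "ergodic m A \<longleftrightarrow> preserves_measure m A \<and>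
     (\<forall>E\<in>sets m. A -` E \<inter> space m = E \<longrightarrow> measure m E = 0 \<or> measure m E = 1)"

definition weakly_mixing :: "'a measure \<Rightarrow> ('a \<Rightarrow> 'a) \<Rightarrow> bool" where
  "weakly_mixing m A \<longleftrightarrow> preserves_measure m A \<and>
     (\<forall>E\<in>sets m. \<forall>F\<in>sets m.
        (\<lambda>N. (\<Sum>k<N. \<bar>measure m ((A ^^ k) -` E \<inter> F) - measure m E * measure m F\<bar>) / real N)
          \<longlonglongrightarrow> 0)"

end

theory Submission
  imports Defs
begin

text \<open>
  Let \<open>G\<close> be the universal cover of the group of orientation-preserving motions of the plane,
  times a line: on \<open>\<real>\<^sup>4\<close>, the coordinate \<open>t = x\<^sub>1\<close> acts on the plane of the coordinates \<open>0\<close> and \<open>2\<close> as the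
  rotation through \<open>2 \<pi> t\<close>, and the coordinate \<open>3\<close> is central. Integral angles act trivially, so
  for \<open>\<Gamma> = \<int>\<^sup>4\<close> the coset \<open>\<Gamma> g\<close> is just the translate \<open>g + \<int>\<^sup>4\<close>, although \<open>G\<close> is not commutative.
  Hence \<open>\<Gamma>\G\<close> is the flat torus \<open>\<real>\<^sup>4/\<int>\<^sup>4\<close>; but the left-invariant frame of \<open>G\<close> turns against the flat
  one as \<open>t\<close> runs around the torus. This gap between being left-invariant and being constant in flat
  coordinates is what the example exploits.

  Every translation of the flat torus is an affine automorphism of \<open>\<Gamma>\G\<close>: left multiplication by
  \<open>a\<close> rotates the plane, and the linear part rotates it back (\<open>affine_torus_translation\<close>). In flat
  charts it has the identity as differential, so it preserves the constant structure \<open>J\<close> that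
  is multiplication by \<open>\<i>\<close> on \<open>\<complex>\<^sup>2\<close> with coordinates \<open>x\<^sub>0 + \<i> x\<^sub>1\<close> and \<open>x\<^sub>2 + \<i> x\<^sub>3\<close>
  (\<open>torus_J_invariant\<close>). This \<open>J\<close> exchanges the rotated plane with the other two directions and so
  does not commute with a quarter turn; hence it is not constant in the left-invariant frame
  (\<open>torus_J_not_left_invariant\<close>).

  The translation vector consists of powers of a transcendental number. By Kronecker's theorem its
  multiples are dense in the torus (\<open>equidistributing_vector\<close>), and a set invariant under a dense group
  of translations is null or conull (\<open>dense_translations_ergodic\<close>), which gives ergodicity. A translation
  is not weakly mixing: a thin strip cannot meet two consecutive ones of its images when each step
  is large (\<open>not_weakly_mixing_of_disjoint_returns\<close>).

  The geometric side rests on one observation: read in charts of the torus, translations and changes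
  of charts agree near every point with a translation of \<open>\<real>\<^sup>4\<close> (\<open>torus_transition\<close>). Smoothness,
  Jacobians and holomorphy are therefore proved once, for maps with that property.
\<close>

section \<open>Elementary functions and local translations\<close>

text \<open>
  The iterated partial derivatives in \<^const>\<open>smooth_fun_on\<close> range over all orders, so smoothness is
  derived from a class of functions closed under partial derivatives and consisting of continuous
  functions. This class is just large enough for the group operations.
\<close>

inductive_set elementary :: "((nat \<Rightarrow> real) \<Rightarrow> real) set" where
  const: "(\<lambda>x. c) \<in> elementary"
| coord: "(\<lambda>x. x i) \<in> elementary"
| add: "f \<in> elementary \<Longrightarrow> g \<in> elementary \<Longrightarrow> (\<lambda>x. f x + g x) \<in> elementary"
| mult: "f \<in> elementary \<Longrightarrow> g \<in> elementary \<Longrightarrow> (\<lambda>x. f x * g x) \<in> elementary"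
| sin: "f \<in> elementary \<Longrightarrow> (\<lambda>x. sin (f x)) \<in> elementary"
| cos: "f \<in> elementary \<Longrightarrow> (\<lambda>x. cos (f x)) \<in> elementary"

lemma elementary_uminus: "f \<in> elementary \<Longrightarrow> (\<lambda>x. - f x) \<in> elementary"
  using elementary.mult[OF elementary.const[of "-1"]] by simp

lemma elementary_diff: "f \<in> elementary \<Longrightarrow> g \<in> elementary \<Longrightarrow> (\<lambda>x. f x - g x) \<in> elementary"
  using elementary.add[OF _ elementary_uminus] by simp

lemmas elementary_intros = elementary.intros elementary_uminus elementary_diff

lemma elementary_continuous: "f \<in> elementary \<Longrightarrow> continuous_on S f"
  by (induction rule: elementary.induct)
    (auto intro!: continuous_intros continuous_on_subset[OF continuous_on_product_coordinates])

lemma elementary_derivative: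
  assumes "f \<in> elementary"
  shows "\<exists>f'\<in>elementary. \<forall>x. ((\<lambda>t. f (x(i := t))) has_real_derivative f' x) (at (x i))"
  using assms
proof induction
  case (const c)
  show ?case by (intro bexI[of _ "\<lambda>_. 0"]) (auto intro: elementary.const)
next
  case (coord j)
  show ?case
    by (intro bexI[of _ "\<lambda>_. if i = j then 1 else 0"]) (auto intro: elementary.const)
next
  case (add f g)
  then obtain f' g' where "f' \<in> elementary" "g' \<in> elementary"
    "\<And>x. ((\<lambda>t. f (x(i := t))) has_real_derivative f' x) (at (x i))"
    "\<And>x. ((\<lambda>t. g (x(i := t))) has_real_derivative g' x) (at (x i))" by blast
  note d = this
  show ?case
    by (intro bexI[of _ "\<lambda>x. f' x + g' x"] allI elementary.add DERIV_add d)
next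
  case (mult f g)
  then obtain f' g' where "f' \<in> elementary" "g' \<in> elementary"
    "\<And>x. ((\<lambda>t. f (x(i := t))) has_real_derivative f' x) (at (x i))"
    "\<And>x. ((\<lambda>t. g (x(i := t))) has_real_derivative g' x) (at (x i))" by blast
  note d = this
  have "((\<lambda>t. f (x(i := t)) * g (x(i := t))) has_real_derivative f' x * g x + g' x * f x) (at (x i))" for x
    using DERIV_mult[OF d(3)[of x] d(4)[of x]] by simp
  with mult.hyps d(1,2) show ?case
    by (intro bexI[of _ "\<lambda>x. f' x * g x + g' x * f x"]) (auto intro!: elementary_intros simp del: fun_upd_apply)
next
  case (sin f)
  then obtain f' where "f' \<in> elementary"
    "\<And>x. ((\<lambda>t. f (x(i := t))) has_real_derivative f' x) (at (x i))" by blast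
  note d = this
  have "((\<lambda>t. sin (f (x(i := t)))) has_real_derivative cos (f x) * f' x) (at (x i))" for x
    using DERIV_fun_sin[OF d(2)[of x]] by simp
  with sin.hyps d(1) show ?case
    by (intro bexI[of _ "\<lambda>x. cos (f x) * f' x"]) (auto intro!: elementary_intros simp del: fun_upd_apply)
next
  case (cos f)
  then obtain f' where "f' \<in> elementary"
    "\<And>x. ((\<lambda>t. f (x(i := t))) has_real_derivative f' x) (at (x i))" by blast
  note d = this
  have "((\<lambda>t. cos (f (x(i := t)))) has_real_derivative - sin (f x) * f' x) (at (x i))" for x
    using DERIV_fun_cos[OF d(2)[of x]] by simp
  with cos.hyps d(1) show ?case
    by (intro bexI[of _ "\<lambda>x. - sin (f x) * f' x"]) (auto intro!: elementary_intros simp del: fun_upd_apply)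
qed

lemma elementary_partial_deriv: "f \<in> elementary \<Longrightarrow> partial_deriv i f \<in> elementary"
proof -
  assume "f \<in> elementary"
  then obtain f' where f': "f' \<in> elementary"
    "\<And>x. ((\<lambda>t. f (x(i := t))) has_real_derivative f' x) (at (x i))"
    using elementary_derivative by blast
  then have "partial_deriv i f = f'"
    unfolding partial_deriv_def by (intro ext DERIV_imp_deriv) auto
  then show ?thesis using f' by simp
qed

lemma elementary_iterated_partial_deriv:
  "f \<in> elementary \<Longrightarrow> iterated_partial_deriv is f \<in> elementary"
  by (induction "is") (auto intro: elementary_partial_deriv)

lemma openin_Euclidean_space_iff:
  "openin (Euclidean_space n) V \<longleftrightarrow> (\<exists>W. open W \<and> V = W \<inter> topspace (Euclidean_space n))"
  unfolding Euclidean_space_def openin_subtopology euclidean_product_topology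
  by simp

text \<open>
  Varying one of the first \<open>n\<close> coordinates stays inside \<open>\<real>\<^sup>n\<close>; that is why the derivatives at a point
  of an open subset depend only on the values in that subset.
\<close>

lemma eventually_update_in:
  assumes V: "openin (Euclidean_space n) V" and "x \<in> V" "i < n"
  shows "\<forall>\<^sub>F t in nhds (x i). x(i := t) \<in> V"
proof -
  obtain W where W: "open W" "V = W \<inter> topspace (Euclidean_space n)"
    using V unfolding openin_Euclidean_space_iff by blast
  have "continuous_on UNIV (\<lambda>t. x(i := t))"
    proof (intro continuous_on_coordinatewise_then_product)
    show "continuous_on UNIV (\<lambda>t. (x(i := t)) j)" for j
      by (cases "j = i") auto
  qed
  then have "open ((\<lambda>t. x(i := t)) -` W)"
    using W(1) by (intro open_vimage) auto
  then have "\<forall>\<^sub>F t in nhds (x i). t \<in> (\<lambda>t. x(i := t)) -` W"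
    using assms W by (intro eventually_nhds_in_open) auto
  then show ?thesis
    by eventually_elim (use assms W in \<open>auto simp: topspace_Euclidean_space\<close>)
qed

lemma partial_deriv_cong:
  assumes "openin (Euclidean_space n) V" "\<And>y. y \<in> V \<Longrightarrow> f y = g y" "x \<in> V" "i < n"
  shows "partial_deriv i f x = partial_deriv i g x"
  unfolding partial_deriv_def
  by (intro deriv_cong_ev eventually_mono[OF eventually_update_in[OF assms(1,3,4)]]) (auto intro: assms)

lemma iterated_partial_deriv_cong:
  assumes "openin (Euclidean_space n) V" "\<And>y. y \<in> V \<Longrightarrow> f y = g y" "set is \<subseteq> {..<n}" "x \<in> V"
  shows "iterated_partial_deriv is f x = iterated_partial_deriv is g x"
  using assms(3,4)
  by (induction "is" arbitrary: x) (auto intro!: partial_deriv_cong[OF assms(1)] assms(2))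

text \<open>
  Smoothness is local, but the elementary function may change from point to point: a transition map
  of the torus is a translation whose vector is only locally constant.
\<close>

lemma smooth_fun_on_locally_elementary:
  assumes local: "\<And>x. x \<in> U \<Longrightarrow> \<exists>V g. openin (Euclidean_space n) V \<and> x \<in> V \<and> g \<in> elementary \<and>
      (\<forall>y\<in>V. f y = g y)"
    and U: "U \<subseteq> topspace (Euclidean_space n)"
  shows "smooth_fun_on n U f"
  unfolding smooth_fun_on_def
proof (intro allI impI conjI ballI)
  fix "is" assume "is": "set is \<subseteq> {..<n}"
  show "continuous_on U (iterated_partial_deriv is f)"
    unfolding continuous_on_def
  proof
    fix x assume x: "x \<in> U"
    then obtain V g where V: "openin (Euclidean_space n) V" "x \<in> V" and g: "g \<in> elementary"
      "\<And>y. y \<in> V \<Longrightarrow> f y = g y" using local[OF x] by metis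
    have eq: "iterated_partial_deriv is f y = iterated_partial_deriv is g y" if "y \<in> V" for y
      using V(1) g(2) "is" that by (rule iterated_partial_deriv_cong)
    obtain W where W: "open W" "V = W \<inter> topspace (Euclidean_space n)"
      using V(1) unfolding openin_Euclidean_space_iff by blast
    have "(iterated_partial_deriv is g \<longlongrightarrow> iterated_partial_deriv is g x) (at x within U)"
      using elementary_continuous[OF elementary_iterated_partial_deriv[OF g(1)], of U] x
      by (simp add: continuous_on_def)
    moreover have "\<forall>\<^sub>F y in at x within U. iterated_partial_deriv is g y = iterated_partial_deriv is f y"
      unfolding eventually_at_topological using W V U by (intro exI[of _ W]) (auto intro!: eq[symmetric])
    ultimately have "(iterated_partial_deriv is f \<longlongrightarrow> iterated_partial_deriv is g x) (at x within U)"
      by (rule Lim_transform_eventually)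
    then show "(iterated_partial_deriv is f \<longlongrightarrow> iterated_partial_deriv is f x) (at x within U)"
      by (simp only: eq[OF V(2)])
  qed
  fix i x assume i: "i < n" and x: "x \<in> U"
  then obtain V g where V: "openin (Euclidean_space n) V" "x \<in> V" and g: "g \<in> elementary"
    "\<And>y. y \<in> V \<Longrightarrow> f y = g y" using local[OF x] by metis
  obtain g' where "((\<lambda>t. iterated_partial_deriv is g (x(i := t))) has_real_derivative g') (at (x i))"
    using elementary_derivative[OF elementary_iterated_partial_deriv[OF g(1), of "is"], of i] by auto
  moreover have "\<forall>\<^sub>F t in nhds (x i). iterated_partial_deriv is g (x(i := t)) = iterated_partial_deriv is f (x(i := t))"
    using eventually_update_in[OF V i]
    by eventually_elim (rule iterated_partial_deriv_cong[OF V(1) g(2) "is", symmetric])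
  ultimately have "((\<lambda>t. iterated_partial_deriv is f (x(i := t))) has_real_derivative g') (at (x i))"
    by (rule iffD1[OF DERIV_cong_ev[OF refl _ refl], rotated])
  then show "(\<lambda>t. iterated_partial_deriv is f (x(i := t))) differentiable at (x i)"
    using real_differentiable_def by blast
qed

lemma smooth_on_elementary:
  assumes "openin (Euclidean_space n) U" "\<And>j. j < m \<Longrightarrow> g j \<in> elementary"
    "\<And>x j. x \<in> U \<Longrightarrow> j < m \<Longrightarrow> f x j = g j x"
  shows "smooth_on n m U f"
  unfolding smooth_on_def
proof (intro allI impI smooth_fun_on_locally_elementary)
  show "U \<subseteq> topspace (Euclidean_space n)" using assms(1) openin_subset by blast
  fix j x assume "j < m" "x \<in> U"
  then show "\<exists>V h. openin (Euclidean_space n) V \<and> x \<in> V \<and> h \<in> elementary \<and> (\<forall>y\<in>V. f y j = h y)"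
    using assms by (intro exI[of _ U] exI[of _ "g j"]) simp
qed

text \<open>
  The form that translations of a flat torus and its changes of charts take in coordinates.
\<close>

definition locally_translation :: "nat \<Rightarrow> (nat \<Rightarrow> real) set \<Rightarrow> ((nat \<Rightarrow> real) \<Rightarrow> nat \<Rightarrow> real) \<Rightarrow> bool" where
  "locally_translation n W F \<longleftrightarrow>
     (\<forall>x\<in>W. \<exists>c V. openin (Euclidean_space n) V \<and> x \<in> V \<and> V \<subseteq> W \<and> (\<forall>y\<in>V. F y = (\<lambda>i. y i + c i)))"

lemma locally_translationE:
  assumes "locally_translation n W F" "x \<in> W"
  obtains V c where "openin (Euclidean_space n) V" "x \<in> V" "V \<subseteq> W"
    "\<forall>y\<in>V. F y = (\<lambda>i. y i + c i)"
proof -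
  have "\<exists>c V. openin (Euclidean_space n) V \<and> x \<in> V \<and> V \<subseteq> W \<and> (\<forall>y\<in>V. F y = (\<lambda>i. y i + c i))"
    using assms unfolding locally_translation_def by (rule bspec)
  then show thesis using that by blast
qed

lemma locally_translation_subset:
  assumes "locally_translation n W F"
  shows "W \<subseteq> topspace (Euclidean_space n)"
proof
  fix x assume "x \<in> W"
  with assms obtain V where "openin (Euclidean_space n) V" "x \<in> V"
    by (rule locally_translationE)
  then show "x \<in> topspace (Euclidean_space n)" using openin_subset by auto
qed

lemma locally_translation_smooth:
  assumes "locally_translation n W F"
  shows "smooth_on n m W F"
  unfolding smooth_on_def
proof (intro allI impI smooth_fun_on_locally_elementary)
  fix j x assume "x \<in> W"
  with assms obtain V c where "openin (Euclidean_space n) V" "x \<in> V" "V \<subseteq> W"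
    "\<forall>y\<in>V. F y = (\<lambda>i. y i + c i)" by (rule locally_translationE)
  then show "\<exists>V g. openin (Euclidean_space n) V \<and> x \<in> V \<and> g \<in> elementary \<and> (\<forall>y\<in>V. F y j = g y)"
    by (intro exI[of _ V] exI[of _ "\<lambda>y. y j + c j"]) (auto intro!: elementary_intros)
next
  show "W \<subseteq> topspace (Euclidean_space n)"
    using assms by (rule locally_translation_subset)
qed

lemma jacobian_map_translation:
  assumes "openin (Euclidean_space n) V" "x \<in> V" "\<forall>y\<in>V. F y = (\<lambda>i. y i + c i)"
    and u: "u \<in> topspace (Euclidean_space n)"
  shows "jacobian_map n F x u = u"
proof
  fix i
  have "partial_deriv j (\<lambda>y. F y i) x = (if j = i then 1 else 0)" if "j < n" for j
  proof -
    have "partial_deriv j (\<lambda>y. F y i) x = partial_deriv j (\<lambda>y. y i + c i) x"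
      by (rule partial_deriv_cong[OF assms(1) _ assms(2) that]) (simp add: assms(3))
    also have "\<dots> = (if j = i then 1 else 0)"
      unfolding partial_deriv_def by (rule DERIV_imp_deriv) (auto intro!: derivative_eq_intros)
    finally show ?thesis .
  qed
  then have "jacobian_map n F x u i = (\<Sum>j<n. if j = i then u j else 0)"
    unfolding jacobian_map_def by (intro sum.cong) auto
  also have "\<dots> = u i" using u by (simp add: topspace_Euclidean_space)
  finally show "jacobian_map n F x u i = u i" .
qed

lemma locally_translation_jacobian:
  assumes "locally_translation n W F" "x \<in> W" "u \<in> topspace (Euclidean_space n)"
  shows "jacobian_map n F x u = u"
proof -
  from assms(1,2) obtain V c where V: "openin (Euclidean_space n) V" "x \<in> V" "V \<subseteq> W"
    "\<forall>y\<in>V. F y = (\<lambda>i. y i + c i)" by (rule locally_translationE)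
  from V(1,2,4) assms(3) show ?thesis by (rule jacobian_map_translation)
qed

lemma Euclidean_space_eq: "Euclidean_space n = top_of_set (topspace (Euclidean_space n))"
  by (simp add: Euclidean_space_def euclidean_product_topology)

lemma topspace_Euclidean_closed:
  assumes "x \<in> topspace (Euclidean_space n)" "y \<in> topspace (Euclidean_space n)"
  shows "(\<lambda>i. x i + y i) \<in> topspace (Euclidean_space n)" "(\<lambda>i. x i - y i) \<in> topspace (Euclidean_space n)"
    "(\<lambda>i. - x i) \<in> topspace (Euclidean_space n)"
  using assms by (auto simp: topspace_Euclidean_space)

lemma continuous_on_coordinate: "continuous_on S (\<lambda>x. x i :: real)"
  by (rule continuous_on_subset[OF continuous_on_product_coordinates]) simp

lemma openin_Euclidean_translate:
  assumes "openin (Euclidean_space n) V" "c \<in> topspace (Euclidean_space n)"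
  shows "openin (Euclidean_space n) {x \<in> topspace (Euclidean_space n). (\<lambda>i. x i + c i) \<in> V}"
proof -
  have "continuous_map (Euclidean_space n) (Euclidean_space n) (\<lambda>x i. x i + c i)"
    using assms(2) by (intro continuous_map_Euclidean_space_add) auto
  then show ?thesis using assms(1) by (rule openin_continuous_map_preimage)
qed

section \<open>Sets invariant under translations\<close>

lemma nn_integral_lborel_translate:
  fixes f :: "'a::euclidean_space \<Rightarrow> ennreal"
  assumes [measurable]: "f \<in> borel_measurable borel"
  shows "(\<integral>\<^sup>+x. f (x + c) \<partial>lborel) = (\<integral>\<^sup>+x. f x \<partial>lborel)"
proof -
  have "(\<integral>\<^sup>+x. f x \<partial>lborel) = (\<integral>\<^sup>+x. f x \<partial>distr lborel borel ((+) c))"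
    by (simp only: lborel_distr_plus)
  also have "\<dots> = (\<integral>\<^sup>+x. f (x + c) \<partial>lborel)"
    by (subst nn_integral_distr) (simp_all add: add.commute)
  finally show ?thesis by simp
qed

lemma emeasure_lborel_translate:
  fixes S :: "'a::euclidean_space set"
  assumes [measurable]: "S \<in> sets borel"
  shows "emeasure lborel {x. x + c \<in> S} = emeasure lborel S"
proof -
  have "emeasure lborel {x. x + c \<in> S} = (\<integral>\<^sup>+x. indicator {x. x + c \<in> S} x \<partial>lborel)"
    by (subst nn_integral_indicator) auto
  also have "\<dots> = (\<integral>\<^sup>+x. indicator S (x + c) \<partial>lborel)"
    by (intro nn_integral_cong) (simp split: split_indicator)
  also have "\<dots> = emeasure lborel S"
    by (subst nn_integral_lborel_translate) auto
  finally show ?thesis .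
qed

text \<open>
  Only a one-sided comparison is available for a limit \<open>t\<close> of elements of \<open>H\<close>: the indicator function
  of an open set is lower semicontinuous, so Fatou's lemma applies.
\<close>

lemma dense_translations_open_le:
  fixes E :: "'a::euclidean_space set"
  assumes [measurable]: "E \<in> sets borel"
    and dense: "closure H = UNIV"
    and inv: "\<And>h x. h \<in> H \<Longrightarrow> x + h \<in> E \<longleftrightarrow> x \<in> E"
    and U: "open U"
  shows "emeasure lborel (E \<inter> {x. x + t \<in> U}) \<le> emeasure lborel (E \<inter> U)"
proof -
  have [measurable]: "U \<in> sets borel" using U by simp
  obtain h where h: "\<And>n. h n \<in> H" "h \<longlonglongrightarrow> t"
    using dense closure_sequential[of t H] by auto
  have hinv: "emeasure lborel (E \<inter> {x. x + h n \<in> U}) = emeasure lborel (E \<inter> U)" for n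
  proof -
    have "E \<inter> {x. x + h n \<in> U} = {x. x + h n \<in> E \<inter> U}"
      using inv[OF h(1)] by auto
    then show ?thesis using emeasure_lborel_translate[of "E \<inter> U" "h n"] by simp
  qed
  have pointwise: "indicator (E \<inter> {x. x + t \<in> U}) x
      \<le> liminf (\<lambda>n. indicator (E \<inter> {x. x + h n \<in> U}) x :: ennreal)" for x
  proof (cases "x \<in> E \<and> x + t \<in> U")
    case True
    have "(\<lambda>n. x + h n) \<longlonglongrightarrow> x + t" by (intro tendsto_intros h)
    then have "\<forall>\<^sub>F n in sequentially. x + h n \<in> U"
      using U True by (metis topological_tendstoD)
    then have "\<forall>\<^sub>F n in sequentially. 1 \<le> (indicator (E \<inter> {x. x + h n \<in> U}) x :: ennreal)"
      by eventually_elim (use True in auto)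
    then have "1 \<le> liminf (\<lambda>n. indicator (E \<inter> {x. x + h n \<in> U}) x :: ennreal)"
      by (rule Liminf_bounded)
    then show ?thesis using True by simp
  qed (auto simp: indicator_def)
  have "emeasure lborel (E \<inter> {x. x + t \<in> U}) = (\<integral>\<^sup>+x. indicator (E \<inter> {x. x + t \<in> U}) x \<partial>lborel)"
    by (subst nn_integral_indicator) auto
  also have "\<dots> \<le> (\<integral>\<^sup>+x. liminf (\<lambda>n. indicator (E \<inter> {x. x + h n \<in> U}) x) \<partial>lborel)"
    by (intro nn_integral_mono pointwise)
  also have "\<dots> \<le> liminf (\<lambda>n. \<integral>\<^sup>+x. indicator (E \<inter> {x. x + h n \<in> U}) x \<partial>lborel)"
    by (intro nn_integral_liminf) measurable
  also have "\<dots> = emeasure lborel (E \<inter> U)"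
    by (subst nn_integral_indicator) (auto simp: hinv Liminf_const)
  finally show ?thesis .
qed

text \<open>
  Outer regularity, applied to the complement of \<open>E\<close>, turns the comparison for open sets into
  \<open>\<lambda>(E \<inter> (- E - t)) = 0\<close> for every \<open>t\<close>. Integrating over \<open>t\<close> and exchanging the integrals yields
  \<open>\<lambda>(E) * \<lambda>(- E) = 0\<close>. No fundamental domain enters, so \<open>E\<close> may have infinite measure.
\<close>

lemma dense_translations_ergodic:
  fixes E :: "'a::euclidean_space set"
  assumes E [measurable]: "E \<in> sets borel"
    and dense: "closure H = UNIV"
    and inv: "\<And>h x. h \<in> H \<Longrightarrow> x + h \<in> E \<longleftrightarrow> x \<in> E"
  shows "emeasure lborel E = 0 \<or> emeasure lborel (- E) = 0"
proof -
  have null: "emeasure lborel (E \<inter> {x. x + t \<in> - E}) = 0" for t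
  proof -
    have "emeasure lborel (E \<inter> {x. x + t \<in> - E}) \<le> ennreal e" if e: "e > 0" for e
    proof -
      have "- E \<in> sets lebesgue" using E by (metis borel_comp sets_completionI_sets sets_lborel)
      then obtain U where U: "open U" "- E \<subseteq> U" "emeasure lebesgue (U - - E) < ennreal e"
        by (rule sets_lebesgue_outer_open[OF _ e])
      have [measurable]: "U \<in> sets borel" using U by simp
      have "emeasure lborel (E \<inter> {x. x + t \<in> - E}) \<le> emeasure lborel (E \<inter> {x. x + t \<in> U})"
        by (rule emeasure_mono) (use U in auto)
      also have "\<dots> \<le> emeasure lborel (E \<inter> U)"
        by (rule dense_translations_open_le[OF E dense inv U(1)])
      also have "\<dots> = emeasure lebesgue (U - - E)"
        by (simp add: Diff_eq Int_commute)
      finally show ?thesis using U(3) by simp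
    qed
    then show ?thesis
      by (metis ennreal_le_epsilon add.left_neutral le_zero_eq)
  qed
  have "(\<integral>\<^sup>+t. (\<integral>\<^sup>+x. indicator E x * indicator (- E) (x + t) \<partial>lborel) \<partial>lborel) =
      (\<integral>\<^sup>+(t::'a). emeasure lborel (E \<inter> {x. x + t \<in> - E}) \<partial>lborel)"
  proof (intro nn_integral_cong)
    fix t :: 'a
    have "(\<integral>\<^sup>+x. indicator E x * indicator (- E) (x + t) \<partial>lborel) =
        (\<integral>\<^sup>+x. indicator (E \<inter> {x. x + t \<in> - E}) x \<partial>lborel)"
      by (intro nn_integral_cong) (auto split: split_indicator)
    also have "\<dots> = emeasure lborel (E \<inter> {x. x + t \<in> - E})"
      by (subst nn_integral_indicator) auto
    finally show "(\<integral>\<^sup>+x. indicator E x * indicator (- E) (x + t) \<partial>lborel) =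
        emeasure lborel (E \<inter> {x. x + t \<in> - E})" .
  qed
  also have "\<dots> = 0" by (simp only: null) simp
  finally have zero:
    "(\<integral>\<^sup>+t. (\<integral>\<^sup>+x. indicator E x * indicator (- E) (x + t) \<partial>lborel) \<partial>lborel) = 0" .
  have "(\<integral>\<^sup>+t. (\<integral>\<^sup>+x. indicator E x * indicator (- E) (x + t) \<partial>lborel) \<partial>lborel) =
      (\<integral>\<^sup>+x. (\<integral>\<^sup>+t. indicator E x * indicator (- E) (x + t) \<partial>lborel) \<partial>lborel)"
    by (rule lborel_pair.Fubini') measurable
  also have "\<dots> = (\<integral>\<^sup>+x. indicator E x * emeasure lborel (- E) \<partial>lborel)"
  proof (intro nn_integral_cong)
    fix x :: 'a
    have "(\<integral>\<^sup>+t. indicator E x * indicator (- E) (x + t) \<partial>lborel) =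
        indicator E x * (\<integral>\<^sup>+t. indicator (- E) (t + x) \<partial>lborel)"
      by (subst nn_integral_cmult) (simp_all add: add.commute)
    also have "\<dots> = indicator E x * emeasure lborel (- E)"
      by (subst nn_integral_lborel_translate) auto
    finally show "(\<integral>\<^sup>+t. indicator E x * indicator (- E) (x + t) \<partial>lborel) =
        indicator E x * emeasure lborel (- E)" .
  qed
  also have "\<dots> = emeasure lborel E * emeasure lborel (- E)"
    by (subst nn_integral_multc) auto
  finally show ?thesis using zero by auto
qed

section \<open>The unit cell of the integer lattice\<close>

definition unit_cell :: "'a::euclidean_space set" where
  "unit_cell = {x. \<forall>b\<in>Basis. 0 \<le> x \<bullet> b \<and> x \<bullet> b < 1}"

definition integer_points :: "'a::euclidean_space set" where
  "integer_points = {x. \<forall>b\<in>Basis. x \<bullet> b \<in> \<int>}"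

lemma unit_cell_sets [measurable]: "unit_cell \<in> sets borel"
proof -
  have "unit_cell = (\<Inter>b\<in>Basis. {x::'a. 0 \<le> x \<bullet> b} \<inter> {x. x \<bullet> b < 1})"
    by (auto simp: unit_cell_def)
  also have "\<dots> \<in> sets borel"
    by (intro sets.countable_INT'' sets.finite_INT) auto
  finally show ?thesis .
qed

lemma emeasure_unit_cell: "emeasure lborel (unit_cell :: 'a::euclidean_space set) = 1"
proof (rule antisym)
  have "emeasure lborel (unit_cell :: 'a set) \<le> emeasure lborel (cbox 0 One :: 'a set)"
    by (rule emeasure_mono) (auto simp: unit_cell_def cbox_def less_imp_le)
  then show "emeasure lborel (unit_cell :: 'a set) \<le> 1" by simp
  have "emeasure lborel (box 0 One :: 'a set) \<le> emeasure lborel (unit_cell :: 'a set)"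
    by (rule emeasure_mono) (auto simp: unit_cell_def box_def less_imp_le)
  then show "1 \<le> emeasure lborel (unit_cell :: 'a set)" by simp
qed

lemma countable_integer_points: "countable (integer_points :: 'a::euclidean_space set)"
proof -
  have "integer_points \<subseteq> (\<lambda>f. \<Sum>b\<in>Basis. f b *\<^sub>R b) ` (Basis \<rightarrow>\<^sub>E \<int> :: ('a \<Rightarrow> real) set)"
  proof
    fix x :: 'a assume x: "x \<in> integer_points"
    have "x = (\<Sum>b\<in>Basis. restrict (\<lambda>b. x \<bullet> b) Basis b *\<^sub>R b)"
      by (simp add: euclidean_representation)
    moreover have "restrict (\<lambda>b. x \<bullet> b) Basis \<in> Basis \<rightarrow>\<^sub>E \<int>"
      using x by (auto simp: integer_points_def)
    ultimately show "x \<in> (\<lambda>f. \<Sum>b\<in>Basis. f b *\<^sub>R b) ` (Basis \<rightarrow>\<^sub>E \<int>)" by blast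
  qed
  moreover have "countable (Basis \<rightarrow>\<^sub>E \<int> :: ('a \<Rightarrow> real) set)"
    by (intro countable_PiE) (auto simp: countable_int)
  ultimately show ?thesis by (meson countable_image countable_subset)
qed

lemma integer_points_uminus: "k \<in> integer_points \<Longrightarrow> - k \<in> integer_points"
  by (auto simp: integer_points_def)

lemma unit_cell_translate_unique:
  assumes "k \<in> integer_points" "l \<in> integer_points" "x + k \<in> unit_cell" "x + l \<in> unit_cell"
  shows "k = l"
proof (rule euclidean_eqI)
  fix b :: 'a assume b: "b \<in> Basis"
  obtain m n where "k \<bullet> b = of_int m" "l \<bullet> b = of_int n"
    using assms(1,2) b unfolding integer_points_def Ints_def by blast
  moreover have "0 \<le> x \<bullet> b + k \<bullet> b" "x \<bullet> b + k \<bullet> b < 1" "0 \<le> x \<bullet> b + l \<bullet> b" "x \<bullet> b + l \<bullet> b < 1"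
    using assms(3,4) b by (auto simp: unit_cell_def inner_add_left)
  moreover from calculation have "\<bar>real_of_int (m - n)\<bar> < 1" by simp
  then have "m = n" by linarith
  ultimately show "k \<bullet> b = l \<bullet> b" by simp
qed

lemma unit_cell_translate_exists:
  obtains k where "k \<in> integer_points" "x + k \<in> unit_cell"
proof
  let ?k = "- (\<Sum>b\<in>Basis. of_int \<lfloor>x \<bullet> b\<rfloor> *\<^sub>R b)"
  show "?k \<in> integer_points" by (auto simp: integer_points_def)
  show "x + ?k \<in> unit_cell"
    by (auto simp: unit_cell_def inner_diff_left) linarith
qed

lemma emeasure_decompose_cells:
  fixes S :: "'a::euclidean_space set"
  assumes [measurable]: "f \<in> borel_measurable borel" "S \<in> sets borel"
  shows "emeasure lborel S =
    (\<integral>\<^sup>+k. emeasure lborel {x \<in> S. f x + k \<in> unit_cell} \<partial>count_space (integer_points :: 'a set))"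
proof -
  have "S = (\<Union>k\<in>integer_points. {x \<in> S. f x + k \<in> unit_cell})"
    using unit_cell_translate_exists by blast
  moreover have "disjoint_family_on (\<lambda>k. {x \<in> S. f x + k \<in> unit_cell}) integer_points"
    unfolding disjoint_family_on_def using unit_cell_translate_unique by fastforce
  ultimately show ?thesis
    using emeasure_UN_countable[of integer_points "\<lambda>k. {x \<in> S. f x + k \<in> unit_cell}" lborel]
      countable_integer_points by simp
qed

text \<open>
  The unit cell need not be mapped to itself. Cutting its image along the lattice translates of the
  cell and moving the pieces back reassembles the cell, since \<open>R\<close> commutes with these translations.
\<close>

lemma emeasure_unit_cell_invariant:
  fixes R :: "'a::euclidean_space \<Rightarrow> 'a"
  assumes R [measurable]: "R \<in> borel_measurable borel" and pres: "distr lborel borel R = lborel"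
    and comm: "\<And>x k. k \<in> integer_points \<Longrightarrow> R (x + k) = R x + k"
    and E [measurable]: "E \<in> sets borel"
    and per: "\<And>x k. k \<in> integer_points \<Longrightarrow> x + k \<in> E \<longleftrightarrow> x \<in> E"
  shows "emeasure lborel {x \<in> unit_cell. R x \<in> E} = emeasure lborel (unit_cell \<inter> E)"
proof -
  have "emeasure lborel {x \<in> unit_cell. R x \<in> E} =
      (\<integral>\<^sup>+k. emeasure lborel {x \<in> {x \<in> unit_cell. R x \<in> E}. R x + k \<in> unit_cell} \<partial>count_space integer_points)"
    by (rule emeasure_decompose_cells) measurable
  also have "\<dots> = (\<integral>\<^sup>+k. emeasure lborel {x \<in> {x. R x \<in> unit_cell \<inter> E}. x + - k \<in> unit_cell} \<partial>count_space integer_points)"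
  proof (rule nn_integral_cong)
    fix k :: 'a assume "k \<in> space (count_space integer_points)"
    then have k: "- k \<in> integer_points" by (simp add: integer_points_uminus)
    have "emeasure lborel {x \<in> {x. R x \<in> unit_cell \<inter> E}. x + - k \<in> unit_cell} =
        emeasure lborel {x. x + - k \<in> {x \<in> unit_cell. R x \<in> E \<and> R x + k \<in> unit_cell}}"
      by (intro arg_cong[where f = "emeasure lborel"])
        (use comm[OF k] per[OF k] in auto)
    also have "\<dots> = emeasure lborel {x \<in> unit_cell. R x \<in> E \<and> R x + k \<in> unit_cell}"
      by (rule emeasure_lborel_translate) measurable
    finally show "emeasure lborel {x \<in> {x \<in> unit_cell. R x \<in> E}. R x + k \<in> unit_cell} =
        emeasure lborel {x \<in> {x. R x \<in> unit_cell \<inter> E}. x + - k \<in> unit_cell}"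
      by (simp add: conj_assoc)
  qed
  also have "\<dots> = (\<integral>\<^sup>+k. emeasure lborel {x \<in> {x. R x \<in> unit_cell \<inter> E}. x + k \<in> unit_cell} \<partial>count_space integer_points)"
    by (rule nn_integral_bij_count_space[where g = uminus])
      (auto intro!: bij_betwI[where g = uminus] integer_points_uminus)
  also have "\<dots> = emeasure lborel {x. R x \<in> unit_cell \<inter> E}"
    by (rule emeasure_decompose_cells[symmetric]) measurable
  also have "\<dots> = emeasure (distr lborel borel R) (unit_cell \<inter> E)"
    by (subst emeasure_distr) (auto simp: vimage_def)
  finally show ?thesis by (simp add: pres)
qed

text \<open>
  Right multiplications of the group have this form in suitable coordinates. For a fixed second
  coordinate the map is a translation of the first, so Fubini's theorem reduces the claim to
  translation invariance.
\<close>

lemma lborel_distr_shear: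
  fixes h :: "'b::euclidean_space \<Rightarrow> 'a::euclidean_space"
  assumes [measurable]: "h \<in> borel_measurable borel"
  shows "distr lborel borel (\<lambda>(z, w). (z + h w, w + c)) = lborel"
proof (rule measure_eqI)
  fix S :: "('a \<times> 'b) set" assume "S \<in> sets (distr lborel borel (\<lambda>(z, w). (z + h w, w + c)))"
  then have S [measurable]: "S \<in> sets (borel \<Otimes>\<^sub>M borel)" by (simp only: borel_prod sets_distr)
  have [measurable]: "(\<lambda>(z, w). (z + h w, w + c)) \<in> borel_measurable (borel \<Otimes>\<^sub>M borel)"
    by (simp add: borel_prod[symmetric] split_beta')
  have fub: "(\<integral>\<^sup>+p. f p \<partial>lborel) = (\<integral>\<^sup>+w. (\<integral>\<^sup>+z. f (z, w) \<partial>lborel) \<partial>lborel)"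
    if [measurable]: "f \<in> borel_measurable (borel \<Otimes>\<^sub>M borel)" for f :: "'a \<times> 'b \<Rightarrow> ennreal"
  proof -
    have "(\<integral>\<^sup>+p. f p \<partial>lborel) = (\<integral>\<^sup>+p. f p \<partial>(lborel \<Otimes>\<^sub>M lborel))" by (simp only: lborel_prod)
    also have "\<dots> = (\<integral>\<^sup>+w. (\<integral>\<^sup>+z. f (z, w) \<partial>lborel) \<partial>lborel)"
      by (rule lborel_pair.nn_integral_snd[symmetric]) simp
    finally show ?thesis .
  qed
  have "emeasure (distr lborel borel (\<lambda>(z, w). (z + h w, w + c))) S =
      (\<integral>\<^sup>+p. indicator S p \<partial>distr lborel borel (\<lambda>(z, w). (z + h w, w + c)))"
    using S by (subst nn_integral_indicator) (auto simp flip: borel_prod)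
  also have "\<dots> = (\<integral>\<^sup>+p. indicator S ((\<lambda>(z, w). (z + h w, w + c)) p) \<partial>lborel)"
    using S by (subst nn_integral_distr) (auto simp flip: borel_prod)
  also have "\<dots> = (\<integral>\<^sup>+w. (\<integral>\<^sup>+z. indicator S (z + h w, w + c) \<partial>lborel) \<partial>lborel)"
    by (subst fub) auto
  also have "\<dots> = (\<integral>\<^sup>+w. (\<integral>\<^sup>+z. indicator S (z, w + c) \<partial>lborel) \<partial>lborel)"
    by (intro nn_integral_cong nn_integral_lborel_translate[where f = "\<lambda>z. indicator S (z, _ + c)"])
      measurable
  also have "\<dots> = (\<integral>\<^sup>+w. (\<integral>\<^sup>+z. indicator S (z, w) \<partial>lborel) \<partial>lborel)"
    by (rule nn_integral_lborel_translate[where f = "\<lambda>w. \<integral>\<^sup>+z. indicator S (z, w) \<partial>lborel"])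
      measurable
  also have "\<dots> = (\<integral>\<^sup>+p. indicator S p \<partial>lborel)"
    by (subst fub) auto
  also have "\<dots> = emeasure lborel S"
    using S by (subst nn_integral_indicator) (auto simp flip: borel_prod)
  finally show "emeasure (distr lborel borel (\<lambda>(z, w). (z + h w, w + c))) S = emeasure lborel S" .
qed simp

section \<open>A vector with dense multiples modulo the integers\<close>

text \<open>
  There are only countably many integer polynomials, each with finitely many roots.
\<close>

lemma transcendental_in_interval:
  fixes l u :: real
  assumes "l < u"
  obtains t where "l < t" "t < u" "\<And>cs. (\<forall>c\<in>set cs. c = 0) \<or> poly (Poly (map real_of_int cs)) t \<noteq> 0"
proof -
  define B where "B = (\<Union>cs\<in>{cs. \<not> (\<forall>c\<in>set cs. c = 0)}. {x. poly (Poly (map real_of_int cs)) x = 0})"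
  have "finite {x. poly (Poly (map real_of_int cs)) x = 0}" if cs: "\<not> (\<forall>c\<in>set cs. c = 0)" for cs
  proof (rule poly_roots_finite)
    obtain i where "i < length cs" "cs ! i \<noteq> 0"
      using cs by (metis in_set_conv_nth)
    then have "coeff (Poly (map real_of_int cs)) i \<noteq> 0" by (simp add: nth_default_def)
    then show "Poly (map real_of_int cs) \<noteq> 0" by force
  qed
  then have "countable B" unfolding B_def
    by (intro countable_UN countableI_type) (simp add: countable_finite)
  then have "\<not> {l<..<u} \<subseteq> B"
    using assms by (meson countable_subset uncountable_open_interval)
  then show thesis using that unfolding B_def by fastforce
qed

text \<open>
  Kronecker's theorem requires \<open>1\<close> and the entries of \<open>a\<close> to be linearly independent over the integers.
  Powers of a transcendental number are. The bounds on the last entry serve the failure of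
  weak mixing; the number itself is that entry.
\<close>

lemma equidistributing_vector:
  assumes "n > 0"
  obtains a :: "nat \<Rightarrow> real" where "1/4 < a (n - 1)" "a (n - 1) < 3/4"
    "\<And>x e. e > 0 \<Longrightarrow> \<exists>(k::int) (m :: nat \<Rightarrow> int). \<forall>i<n. \<bar>of_int k * a i - of_int (m i) - x i\<bar> < e"
proof -
  obtain t :: real where t: "1/4 < t" "t < 3/4"
    and transc: "\<And>cs. (\<forall>c\<in>set cs. c = 0) \<or> poly (Poly (map real_of_int cs)) t \<noteq> 0"
    using transcendental_in_interval[of "1/4" "3/4"] by auto
  interpret M: module "\<lambda>r x. real_of_int r * x"
    by (simp add: module.intro distrib_left distrib_right mult.assoc)
  have inj: "inj_on (\<lambda>i. t ^ i) A" for A :: "nat set"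
  proof -
    have "0 < t" "t < 1" using t by linarith+
    then show ?thesis
      by (intro inj_onI) (metis linorder_neqE_nat power_strict_decreasing_iff less_irrefl)
  qed
  define a where "a i = t ^ (n - i)" for i
  have img: "a ` {..n} = (\<lambda>i. t ^ i) ` {..n}"
  proof -
    have "(\<lambda>i. n - i) ` {..n} = {..n}"
      by (auto simp: image_iff) (metis atMost_iff diff_diff_cancel diff_le_self)
    then show ?thesis unfolding a_def by (metis (no_types, lifting) image_cong image_image)
  qed
  have "M.independent (a ` {..n})"
  proof
    assume "M.dependent (a ` {..n})"
    then obtain u where u: "\<exists>v\<in>a ` {..n}. u v \<noteq> 0" and s: "(\<Sum>v\<in>a ` {..n}. real_of_int (u v) * v) = 0"
      using M.dependent_finite[of "a ` {..n}"] by auto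
    \<comment> \<open>an integer relation between the powers is an integer polynomial with root \<open>t\<close>\<close>
    define cs where "cs = map (\<lambda>i. u (t ^ i)) [0..<Suc n]"
    have "poly (Poly (map real_of_int cs)) t = (\<Sum>i\<le>n. real_of_int (u (t ^ i)) * t ^ i)"
    proof -
      let ?p = "Poly (map real_of_int cs)"
      have "coeff ?p i = 0" if "i > n" for i
        using that by (simp add: cs_def nth_default_def del: upt_Suc)
      then have "degree ?p \<le> n" by (intro degree_le) auto
      then have "poly ?p t = (\<Sum>i\<le>n. coeff ?p i * t ^ i)"
        by (subst poly_as_sum_of_monoms'[symmetric]) (simp_all add: poly_sum poly_monom)
      also have "\<dots> = (\<Sum>i\<le>n. real_of_int (u (t ^ i)) * t ^ i)"
        by (intro sum.cong) (auto simp: cs_def nth_default_def simp del: upt_Suc)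
      finally show ?thesis .
    qed
    also have "\<dots> = (\<Sum>v\<in>a ` {..n}. real_of_int (u v) * v)"
      unfolding img by (subst sum.reindex[OF inj]) simp
    finally have "poly (Poly (map real_of_int cs)) t = 0" using s by simp
    then have "\<forall>c\<in>set cs. c = 0" using transc by blast
    then have "\<forall>i\<le>n. u (t ^ i) = 0" unfolding cs_def by (auto simp del: upt_Suc)
    then show False using u unfolding img by auto
  qed
  moreover have "inj_on a {..n}"
    unfolding a_def by (rule inj_onI) (use inj[of UNIV] in \<open>force dest: injD\<close>)
  moreover have "a n = 1" by (simp add: a_def)
  ultimately have "\<exists>(k::int) (m :: nat \<Rightarrow> int). \<forall>i<n. \<bar>of_int k * a i - of_int (m i) - x i\<bar> < e" if "e > 0" for x e
    using Kronecker_thm_2[of a n e x] that by metis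
  moreover have "a (n - 1) = t" using assms by (simp add: a_def)
  ultimately show thesis using t by (intro that[of a]) auto
qed

section \<open>The group\<close>

definition plane_rot :: "real \<Rightarrow> (nat \<Rightarrow> real) \<Rightarrow> nat \<Rightarrow> real" where
  "plane_rot \<theta> u = (\<lambda>i.
     if i = 0 then cos (2 * pi * \<theta>) * u 0 - sin (2 * pi * \<theta>) * u 2
     else if i = 2 then sin (2 * pi * \<theta>) * u 0 + cos (2 * pi * \<theta>) * u 2
     else u i)"

abbreviation R4 :: "(nat \<Rightarrow> real) set" where
  "R4 \<equiv> topspace (Euclidean_space 4)"

text \<open>
  The coordinates \<open>0\<close> and \<open>2\<close> are the rotated ones, so that in the identification of \<open>\<real>\<^sup>4\<close> with \<open>\<complex>\<^sup>2\<close>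
  used for complex manifolds the rotated plane is not a complex line.
\<close>

definition screw_group :: "(nat \<Rightarrow> real) monoid" where
  "screw_group = \<lparr>carrier = R4, mult = (\<lambda>x y i. x i + plane_rot (x 1) y i), one = (\<lambda>_. 0)\<rparr>"

definition screw_mfd :: "(nat \<Rightarrow> real) mfd" where
  "screw_mfd = \<lparr>mtop = Euclidean_space 4, mdim = 4, atlas = {(R4, \<lambda>x. x)}\<rparr>"

definition int_lattice :: "(nat \<Rightarrow> real) set" where
  "int_lattice = {x \<in> R4. \<forall>i. x i \<in> \<int>}"

abbreviation proj :: "(nat \<Rightarrow> real) \<Rightarrow> (nat \<Rightarrow> real) set" where
  "proj x \<equiv> int_lattice #>\<^bsub>screw_group\<^esub> x"

abbreviation torus :: "(nat \<Rightarrow> real) set mfd" where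
  "torus \<equiv> quotient_manifold screw_group screw_mfd int_lattice"

lemma carrier_screw [simp]: "carrier screw_group = R4"
  and one_screw [simp]: "\<one>\<^bsub>screw_group\<^esub> = (\<lambda>_. 0)"
  and mult_screw: "x \<otimes>\<^bsub>screw_group\<^esub> y = (\<lambda>i. x i + plane_rot (x 1) y i)"
  by (simp_all add: screw_group_def)

lemma screw_mfd_simps [simp]:
  "mtop screw_mfd = Euclidean_space 4" "mdim screw_mfd = 4" "atlas screw_mfd = {(R4, \<lambda>x. x)}"
  by (simp_all add: screw_mfd_def)

lemma zero_R4 [simp]: "(\<lambda>_. 0) \<in> R4"
  by (simp add: topspace_Euclidean_space)

lemma plane_rot_R4: "u \<in> R4 \<Longrightarrow> plane_rot \<theta> u \<in> R4"
  by (auto simp: plane_rot_def topspace_Euclidean_space)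

lemma plane_rot_axis [simp]: "plane_rot \<theta> u (Suc 0) = u 1"
  by (simp add: plane_rot_def)

lemma plane_rot_add: "plane_rot \<theta> (\<lambda>i. u i + v i) = (\<lambda>i. plane_rot \<theta> u i + plane_rot \<theta> v i)"
  by (auto simp: plane_rot_def algebra_simps)

lemma plane_rot_compose: "plane_rot \<theta> (plane_rot \<eta> u) = plane_rot (\<theta> + \<eta>) u"
  by (auto simp: plane_rot_def algebra_simps cos_add sin_add)

lemma plane_rot_Ints: "\<theta> \<in> \<int> \<Longrightarrow> plane_rot \<theta> u = u"
  by (auto simp: plane_rot_def elim!: Ints_cases)

lemma plane_rot_0 [simp]: "plane_rot 0 u = u"
  by (simp add: plane_rot_Ints)

lemma plane_rot_zero [simp]: "plane_rot \<theta> (\<lambda>_. 0) = (\<lambda>_. 0)"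
  by (auto simp: plane_rot_def)

lemma mult_screw_R4: "x \<in> R4 \<Longrightarrow> y \<in> R4 \<Longrightarrow> x \<otimes>\<^bsub>screw_group\<^esub> y \<in> R4"
  unfolding mult_screw by (intro topspace_Euclidean_closed plane_rot_R4)

lemma left_inverse_screw:
  "(\<lambda>i. - plane_rot (- x 1) x i) \<otimes>\<^bsub>screw_group\<^esub> x = \<one>\<^bsub>screw_group\<^esub>"
  by (simp add: mult_screw)

lemma group_screw: "group screw_group"
proof (rule groupI)
  fix x y z
  show "x \<otimes>\<^bsub>screw_group\<^esub> y \<otimes>\<^bsub>screw_group\<^esub> z = x \<otimes>\<^bsub>screw_group\<^esub> (y \<otimes>\<^bsub>screw_group\<^esub> z)"
    by (simp add: mult_screw plane_rot_add plane_rot_compose add.assoc)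
next
  fix x assume "x \<in> carrier screw_group"
  then show "\<exists>y\<in>carrier screw_group. y \<otimes>\<^bsub>screw_group\<^esub> x = \<one>\<^bsub>screw_group\<^esub>"
    by (intro bexI[where P = "\<lambda>y. y \<otimes>\<^bsub>screw_group\<^esub> x = _", OF left_inverse_screw]) (auto intro: topspace_Euclidean_closed plane_rot_R4)
qed (auto simp: mult_screw_R4, simp add: mult_screw)

lemma inv_screw:
  assumes "x \<in> R4"
  shows "inv\<^bsub>screw_group\<^esub> x = (\<lambda>i. - plane_rot (- x 1) x i)"
  using assms by (intro group.inv_equality[OF group_screw left_inverse_screw])
    (auto intro: topspace_Euclidean_closed plane_rot_R4)

lemma subgroup_int_lattice: "subgroup int_lattice screw_group"
proof (rule group.subgroupI[OF group_screw])
  show "int_lattice \<noteq> {}" by (auto simp: int_lattice_def intro!: exI[of _ "\<lambda>_. 0"])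
next
  fix x assume "x \<in> int_lattice"
  then show "inv\<^bsub>screw_group\<^esub> x \<in> int_lattice"
    by (auto simp: inv_screw int_lattice_def plane_rot_Ints topspace_Euclidean_closed)
next
  fix x y assume "x \<in> int_lattice" "y \<in> int_lattice"
  then show "x \<otimes>\<^bsub>screw_group\<^esub> y \<in> int_lattice"
    by (auto simp: mult_screw int_lattice_def plane_rot_Ints topspace_Euclidean_closed)
qed (auto simp: int_lattice_def)

text \<open>
  Lattice points have an integral angle, so left multiplication by them is ordinary translation: the
  quotient does not see that the group is not commutative.
\<close>

lemma proj_eq:
  assumes "x \<in> R4"
  shows "proj x = {y \<in> R4. \<forall>i. y i - x i \<in> \<int>}"
proof (intro equalityI subsetI)
  fix y assume "y \<in> proj x"
  then obtain k where k: "k \<in> int_lattice" "y = k \<otimes>\<^bsub>screw_group\<^esub> x"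
    by (auto simp: r_coset_def)
  then have "y = (\<lambda>i. k i + x i)" by (simp add: mult_screw int_lattice_def plane_rot_Ints)
  then show "y \<in> {y \<in> R4. \<forall>i. y i - x i \<in> \<int>}"
    using k assms by (auto simp: int_lattice_def topspace_Euclidean_closed)
next
  fix y assume y: "y \<in> {y \<in> R4. \<forall>i. y i - x i \<in> \<int>}"
  let ?k = "\<lambda>i. y i - x i"
  have k: "?k \<in> int_lattice"
    using y assms by (auto simp: int_lattice_def topspace_Euclidean_closed)
  moreover have "y = ?k \<otimes>\<^bsub>screw_group\<^esub> x"
    using k by (simp add: mult_screw int_lattice_def plane_rot_Ints)
  ultimately show "y \<in> proj x" unfolding r_coset_def by blast
qed

lemma proj_eq_iff:
  assumes "x \<in> R4" "y \<in> R4"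
  shows "proj x = proj y \<longleftrightarrow> (\<forall>i. y i - x i \<in> \<int>)"
proof
  assume "proj x = proj y"
  then have "y \<in> proj x" using assms by (simp add: proj_eq)
  then show "\<forall>i. y i - x i \<in> \<int>" using assms by (simp add: proj_eq)
next
  assume xy: "\<forall>i. y i - x i \<in> \<int>"
  have "z i - x i \<in> \<int> \<longleftrightarrow> z i - y i \<in> \<int>" for z i
  proof
    assume "z i - x i \<in> \<int>" then have "(z i - x i) - (y i - x i) \<in> \<int>" by (rule Ints_diff) (use xy in blast)
    then show "z i - y i \<in> \<int>" by simp
  next
    assume "z i - y i \<in> \<int>" then have "(z i - y i) + (y i - x i) \<in> \<int>" by (rule Ints_add) (use xy in blast)
    then show "z i - x i \<in> \<int>" by simp
  qed
  then show "proj x = proj y" using assms by (simp add: proj_eq)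
qed

lemma proj_add_cong:
  assumes "x \<in> R4" "y \<in> R4" "c \<in> R4" "proj x = proj y"
  shows "proj (\<lambda>i. x i + c i) = proj (\<lambda>i. y i + c i)"
  using assms by (simp add: proj_eq_iff topspace_Euclidean_closed)

lemma proj_add_int:
  assumes "x \<in> R4" "k \<in> int_lattice"
  shows "proj (\<lambda>i. x i + k i) = proj x"
proof -
  have "(\<lambda>i. x i + k i) \<in> R4" using assms by (auto simp: int_lattice_def topspace_Euclidean_closed)
  then have "proj x = proj (\<lambda>i. x i + k i)"
    using assms by (subst proj_eq_iff) (auto simp: int_lattice_def)
  then show ?thesis by simp
qed

section \<open>The quotient torus\<close>

lemma rcosets_eq: "rcosets\<^bsub>screw_group\<^esub> int_lattice = proj ` R4"
  by (auto simp: RCOSETS_def)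

lemma torus_simps: "mdim torus = 4" "mtop torus = quotient_top screw_group (Euclidean_space 4) int_lattice"
  by (simp_all add: quotient_manifold_def)

lemma openin_torus:
  "openin (mtop torus) W \<longleftrightarrow> W \<subseteq> proj ` R4 \<and> openin (Euclidean_space 4) {x \<in> R4. proj x \<in> W}"
  by (simp add: torus_simps openin_quotient_top rcosets_eq)

lemma topspace_torus: "topspace (mtop torus) = proj ` R4"
proof -
  have "{x \<in> R4. proj x \<in> proj ` R4} = R4" by blast
  then have "openin (mtop torus) (proj ` R4)" by (simp add: openin_torus)
  moreover have "W \<subseteq> proj ` R4" if "openin (mtop torus) W" for W
    using that by (simp add: openin_torus)
  ultimately show ?thesis
    by (metis openin_subset openin_topspace subset_antisym)
qed

lemma quotient_map_proj: "quotient_map (Euclidean_space 4) (mtop torus) proj"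
  unfolding quotient_map_def topspace_torus by (auto simp: openin_torus)

lemma continuous_map_proj: "continuous_map (Euclidean_space 4) (mtop torus) proj"
  by (rule quotient_imp_continuous_map[OF quotient_map_proj])

text \<open>
  The saturation of an open set is the union of its translates by lattice vectors.
\<close>

lemma open_map_proj: "open_map (Euclidean_space 4) (mtop torus) proj"
  unfolding open_map_def
proof (intro allI impI)
  fix V assume V: "openin (Euclidean_space 4) V"
  then have VR: "V \<subseteq> R4" by (rule openin_subset)
  have "{x \<in> R4. proj x \<in> proj ` V} = (\<Union>k\<in>int_lattice. {x \<in> R4. (\<lambda>i. x i + k i) \<in> V})"
  proof (intro equalityI subsetI)
    fix x assume "x \<in> {x \<in> R4. proj x \<in> proj ` V}"
    then obtain v where v: "x \<in> R4" "v \<in> V" "proj x = proj v" by blast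
    then have "\<forall>i. v i - x i \<in> \<int>" using VR proj_eq_iff[of x v] by blast
    then have "(\<lambda>i. v i - x i) \<in> int_lattice"
      using v VR by (auto simp: int_lattice_def topspace_Euclidean_closed)
    moreover have "(\<lambda>i. x i + (v i - x i)) \<in> V" using v by simp
    ultimately show "x \<in> (\<Union>k\<in>int_lattice. {x \<in> R4. (\<lambda>i. x i + k i) \<in> V})"
      using v by blast
  next
    fix x assume "x \<in> (\<Union>k\<in>int_lattice. {x \<in> R4. (\<lambda>i. x i + k i) \<in> V})"
    then obtain k where k: "k \<in> int_lattice" "x \<in> R4" "(\<lambda>i. x i + k i) \<in> V" by blast
    then have "proj x \<in> proj ` V"
      using proj_add_int[OF k(2,1)] by (intro image_eqI[where x = "\<lambda>i. x i + k i"]) auto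
    then show "x \<in> {x \<in> R4. proj x \<in> proj ` V}" using k by simp
  qed
  moreover have "openin (Euclidean_space 4) \<dots>"
    using V by (auto intro!: openin_Euclidean_translate simp: int_lattice_def)
  ultimately show "openin (mtop torus) (proj ` V)"
    using VR by (simp add: openin_torus image_mono)
qed

lemma atlas_torus:
  "atlas torus = {(proj ` U, inv_into U proj) | U. openin (Euclidean_space 4) U \<and> inj_on proj U}"
proof -
  have "(\<lambda>x. x) \<circ> inv_into U proj = inv_into U proj" for U by (simp add: comp_def)
  moreover have "U \<subseteq> R4" if "openin (Euclidean_space 4) U" for U
    using that by (rule openin_subset)
  ultimately show ?thesis by (auto simp: quotient_manifold_def)
qed

lemma torus_chartE:
  assumes "c \<in> atlas torus"
  obtains U where "openin (Euclidean_space 4) U" "inj_on proj U" "c = (proj ` U, inv_into U proj)"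
  using assms by (auto simp: atlas_torus)

lemma chart_inv_torus:
  assumes "inj_on proj U" "x \<in> U"
  shows "chart_inv (proj ` U, inv_into U proj) x = proj x"
proof -
  have "inv_into (proj ` U) (inv_into U proj) (inv_into U proj (proj x)) = proj x"
    using assms by (intro inv_into_f_f inj_on_inv_into) auto
  then show ?thesis using assms by (simp add: chart_inv_def)
qed

text \<open>
  Two points of an open unit cube whose difference is integral coincide.
\<close>

lemma torus_chart_at:
  assumes "x \<in> R4"
  obtains U where "openin (Euclidean_space 4) U" "inj_on proj U" "x \<in> U"
proof
  let ?U = "R4 \<inter> (\<Inter>i<4. {y. \<bar>y i - x i\<bar> < 1/2})"
  have "open (\<Inter>i<(4::nat). {y. \<bar>y i - x i\<bar> < 1/2})"
    by (intro open_INT ballI open_Collect_less continuous_intros continuous_on_coordinate) auto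
  then show "openin (Euclidean_space 4) ?U"
    by (auto simp: openin_Euclidean_space_iff)
  show "inj_on proj ?U"
  proof (rule inj_onI)
    fix y z assume y: "y \<in> ?U" and z: "z \<in> ?U" and eq: "proj y = proj z"
    show "y = z"
    proof
      fix i
      show "y i = z i"
      proof (cases "i < 4")
        case True
        then have "\<bar>y i - x i\<bar> < 1/2" "\<bar>z i - x i\<bar> < 1/2" using y z by auto
        then have "\<bar>z i - y i\<bar> < 1" by linarith
        moreover have "z i - y i \<in> \<int>" using y z eq by (simp add: proj_eq_iff)
        ultimately show ?thesis using Ints_nonzero_abs_less1[of "z i - y i"] by auto
      next
        case False then show ?thesis using y z by (auto simp: topspace_Euclidean_space)
      qed
    qed
  qed
  show "x \<in> ?U" using assms by simp
qed

lemma chart_domain_transition: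
  assumes "inj_on proj U"
  shows "inv_into U proj ` (proj ` U \<inter> f -` D) = {x \<in> U. f (proj x) \<in> D}"
proof (intro equalityI subsetI)
  fix x assume "x \<in> {x \<in> U. f (proj x) \<in> D}"
  then show "x \<in> inv_into U proj ` (proj ` U \<inter> f -` D)"
    using assms by (intro image_eqI[of _ _ "proj x"]) auto
qed (use assms in auto)

text \<open>
  Two lifts of a point differ by a lattice vector, and over a small neighbourhood the sheet that
  lies in \<open>V\<close> is reached by the same vector.
\<close>

lemma local_section_translation:
  assumes V: "openin (Euclidean_space 4) V" "inj_on proj V"
    and b: "b \<in> R4" and xR: "x \<in> R4" and xV: "proj (\<lambda>i. x i + b i) \<in> proj ` V"
  obtains N c where "openin (Euclidean_space 4) N" "x \<in> N"
    "\<forall>y\<in>N. proj (\<lambda>i. y i + b i) \<in> proj ` V \<and>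
      inv_into V proj (proj (\<lambda>i. y i + b i)) = (\<lambda>i. y i + c i)"
proof -
  have VR: "V \<subseteq> R4" using V(1) by (rule openin_subset)
  obtain v where v: "v \<in> V" "proj (\<lambda>i. x i + b i) = proj v" using xV by auto
  define c where "c = (\<lambda>i. v i - x i)"
  have c: "c \<in> R4" using v xR VR by (auto simp: c_def topspace_Euclidean_closed)
  have cb: "v i - (x i + b i) \<in> \<int>" for i
  proof -
    have "(\<lambda>i. x i + b i) \<in> R4" "v \<in> R4" using v xR b VR by (auto simp: topspace_Euclidean_closed)
    from proj_eq_iff[OF this] v(2) show ?thesis by simp
  qed
  define N where "N = {y \<in> R4. (\<lambda>i. y i + c i) \<in> V}"
  have "openin (Euclidean_space 4) N"
    unfolding N_def using V(1) c by (rule openin_Euclidean_translate)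
  moreover have "x \<in> N" using xR v by (simp add: N_def c_def)
  moreover have "\<forall>y\<in>N. proj (\<lambda>i. y i + b i) \<in> proj ` V \<and>
      inv_into V proj (proj (\<lambda>i. y i + b i)) = (\<lambda>i. y i + c i)"
  proof
    fix y assume "y \<in> N"
    then have yR: "y \<in> R4" and yV: "(\<lambda>i. y i + c i) \<in> V" by (auto simp: N_def)
    have "proj (\<lambda>i. y i + b i) = proj (\<lambda>i. y i + c i)"
    proof (subst proj_eq_iff)
      show "\<forall>i. y i + c i - (y i + b i) \<in> \<int>"
      proof
        fix i
        have "y i + c i - (y i + b i) = v i - (x i + b i)" by (simp add: c_def)
        then show "y i + c i - (y i + b i) \<in> \<int>" using cb by (simp only:)
      qed
    qed (use yR b c in \<open>auto intro: topspace_Euclidean_closed\<close>)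
    then show "proj (\<lambda>i. y i + b i) \<in> proj ` V \<and>
        inv_into V proj (proj (\<lambda>i. y i + b i)) = (\<lambda>i. y i + c i)"
      using yV V(2) by simp
  qed
  ultimately show thesis by (rule that)
qed

text \<open>
  With \<open>b = 0\<close> and \<open>f\<close> the identity this covers the changes of charts as well.
\<close>

lemma torus_transition:
  assumes U: "openin (Euclidean_space 4) U" "inj_on proj U"
    and V: "openin (Euclidean_space 4) V" "inj_on proj V"
    and b: "b \<in> R4" and f: "\<And>x. x \<in> R4 \<Longrightarrow> f (proj x) = proj (\<lambda>i. x i + b i)"
  shows "locally_translation 4 (inv_into U proj ` (proj ` U \<inter> f -` (proj ` V)))
    (inv_into V proj \<circ> f \<circ> chart_inv (proj ` U, inv_into U proj))"
  unfolding locally_translation_def chart_domain_transition[OF U(2)]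
proof (intro ballI)
  have UR: "U \<subseteq> R4" using U(1) by (rule openin_subset)
  fix x assume x: "x \<in> {x \<in> U. f (proj x) \<in> proj ` V}"
  then have xR: "x \<in> R4" using UR by blast
  then have "proj (\<lambda>i. x i + b i) \<in> proj ` V" using x f[OF xR] by simp
  with V b xR obtain N c where N: "openin (Euclidean_space 4) N" "x \<in> N"
    and sec: "\<forall>y\<in>N. proj (\<lambda>i. y i + b i) \<in> proj ` V \<and>
      inv_into V proj (proj (\<lambda>i. y i + b i)) = (\<lambda>i. y i + c i)"
    by (rule local_section_translation)
  have "openin (Euclidean_space 4) (U \<inter> N)" using U(1) N(1) by (rule openin_Int)
  moreover have "x \<in> U \<inter> N" using x N by simp
  moreover have "U \<inter> N \<subseteq> {x \<in> U. f (proj x) \<in> proj ` V}"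
  proof
    fix y assume "y \<in> U \<inter> N"
    then show "y \<in> {x \<in> U. f (proj x) \<in> proj ` V}"
      using sec f[of y] UR by auto
  qed
  moreover have "\<forall>y\<in>U \<inter> N. (inv_into V proj \<circ> f \<circ> chart_inv (proj ` U, inv_into U proj)) y = (\<lambda>i. y i + c i)"
  proof
    fix y assume "y \<in> U \<inter> N"
    then show "(inv_into V proj \<circ> f \<circ> chart_inv (proj ` U, inv_into U proj)) y = (\<lambda>i. y i + c i)"
      using sec f[of y] UR by (auto simp: chart_inv_torus[OF U(2)])
  qed
  ultimately show "\<exists>c Va. openin (Euclidean_space 4) Va \<and> x \<in> Va \<and>
      Va \<subseteq> {x \<in> U. f (proj x) \<in> proj ` V} \<and>
      (\<forall>y\<in>Va. (inv_into V proj \<circ> f \<circ> chart_inv (proj ` U, inv_into U proj)) y = (\<lambda>i. y i + c i))"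
    by (intro exI[of _ c] exI[of _ "U \<inter> N"]) simp
qed

section \<open>Topology of the torus and the Lie group structure\<close>

lemma second_countable_euclidean: "second_countable (euclidean :: 'a::second_countable_topology topology)"
proof -
  obtain B :: "'a set set" where B: "countable B" "topological_basis B"
    using ex_countable_basis by blast
  show ?thesis unfolding second_countable_def
  proof (intro exI[of _ B] conjI ballI allI impI)
    fix V assume "V \<in> B" then show "openin euclidean V" using B topological_basis_open by auto
  next
    fix U :: "'a set" and x assume "openin euclidean U \<and> x \<in> U"
    then show "\<exists>V\<in>B. x \<in> V \<and> V \<subseteq> U" using topological_basisE[OF B(2), of U x] by (metis open_openin)
  qed (rule B)
qed

lemma second_countable_Euclidean_space: "second_countable (Euclidean_space n)"
  by (subst Euclidean_space_eq) (intro second_countable_subtopology second_countable_euclidean)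

lemma compact_torus: "compact_space (mtop torus)"
proof -
  define K :: "(nat \<Rightarrow> real) set" where "K = (\<Pi>\<^sub>E i\<in>UNIV. if i < 4 then {0..1} else {0})"
  have "compactin (powertop_real UNIV) K"
    unfolding K_def compactin_PiE by simp
  moreover have KR: "K \<subseteq> R4"
  proof
    fix x assume "x \<in> K"
    then have m: "x i \<in> (if i < 4 then {0..1} else {0})" for i unfolding K_def by (rule PiE_mem) simp
    have "x i = 0" if "i \<ge> 4" for i using m[of i] that by simp
    then show "x \<in> R4" by (simp add: topspace_Euclidean_space)
  qed
  ultimately have "compactin (Euclidean_space 4) K"
    by (simp add: Euclidean_space_def compactin_subtopology topspace_Euclidean_space)
  then have "compactin (mtop torus) (proj ` K)"
    by (rule image_compactin[OF _ continuous_map_proj])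
  moreover have "proj ` K = proj ` R4"
  proof
    show "proj ` K \<subseteq> proj ` R4" by (rule image_mono[OF KR])
  next
    show "proj ` R4 \<subseteq> proj ` K"
    proof
      fix q assume "q \<in> proj ` R4"
      then obtain x where x: "x \<in> R4" "q = proj x" by blast
      have "(\<lambda>i. frac (x i)) \<in> K"
        using x by (auto simp: K_def PiE_iff topspace_Euclidean_space frac_lt_1 less_imp_le)
      moreover have "proj (\<lambda>i. frac (x i)) = proj x"
        using calculation KR x by (subst proj_eq_iff) (auto simp: frac_def)
      ultimately show "q \<in> proj ` K" using x(2) by (metis imageI)
    qed
  qed
  ultimately show ?thesis by (simp add: compact_space_def topspace_torus)
qed

text \<open>
  The map to \<open>exp (2 \<pi> \<i> x\<^sub>i)\<close>, \<open>i < 4\<close>, is continuous and injective on the quotient.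
\<close>

lemma Hausdorff_torus: "Hausdorff_space (mtop torus)"
proof -
  define f :: "(nat \<Rightarrow> real) set \<Rightarrow> nat \<Rightarrow> complex" where "f S = (\<lambda>i. cis (2 * pi * (SOME x. x \<in> S) i))" for S
  have f: "f (proj x) = (\<lambda>i. cis (2 * pi * x i))" if x: "x \<in> R4" for x
  proof
    fix i
    have "x \<in> proj x" using x by (simp add: proj_eq)
    then have "(SOME y. y \<in> proj x) \<in> proj x" by (rule someI[of "\<lambda>y. y \<in> proj x"])
    then obtain k where "(SOME y. y \<in> proj x) i - x i = of_int k"
      using x by (auto simp: proj_eq elim: Ints_cases)
    then have "(SOME y. y \<in> proj x) i = x i + of_int k" by simp
    then show "f (proj x) i = cis (2 * pi * x i)"
      by (simp add: f_def distrib_left flip: cis_mult)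
  qed
  have "continuous_map (Euclidean_space 4) euclidean (\<lambda>x i. cis (2 * pi * x i))"
    unfolding continuous_map_Euclidean_space_iff
    by (intro continuous_on_coordinatewise_then_product continuous_intros continuous_on_coordinate)
  then have "continuous_map (Euclidean_space 4) euclidean (f \<circ> proj)"
    by (rule continuous_map_eq) (simp add: f)
  then have "continuous_map (mtop torus) euclidean f"
    by (rule continuous_compose_quotient_map[OF quotient_map_proj])
  moreover have "inj_on f (topspace (mtop torus))"
  proof (rule inj_onI)
    fix p q assume "p \<in> topspace (mtop torus)" "q \<in> topspace (mtop torus)" and eq: "f p = f q"
    then obtain x y where xy: "x \<in> R4" "y \<in> R4" "p = proj x" "q = proj y"
      by (auto simp: topspace_torus)
    have "y i - x i \<in> \<int>" for i
    proof -
      have "cis (2 * pi * x i) = cis (2 * pi * y i)" using eq xy f by metis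
      then have "exp (2 * pi * y i * \<i>) = exp (2 * pi * x i * \<i>)" by (simp add: cis_conv_exp mult.commute)
      then obtain n where "2 * pi * y i * \<i> = 2 * pi * x i * \<i> + of_int (2 * n) * pi * \<i>"
        unfolding exp_eq by auto
      then have "Im (2 * pi * y i * \<i>) = Im (2 * pi * x i * \<i> + of_int (2 * n) * pi * \<i>)" by simp
      then have "2 * pi * y i = 2 * pi * (x i + of_int n)" by (simp add: algebra_simps)
      then have "y i - x i = of_int n" by (simp only: mult_cancel_left) simp
      then show ?thesis by simp
    qed
    then show "p = q" using xy proj_eq_iff by simp
  qed
  ultimately show ?thesis
    by (rule Hausdorff_space_injective_preimage[OF Hausdorff_space_euclidean])
qed

lemma second_countable_torus: "second_countable (mtop torus)"
  by (rule second_countable_open_map_image[OF continuous_map_proj open_map_proj _ second_countable_Euclidean_space])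
    (simp add: topspace_torus)

lemma torus_chart_homeomorphic:
  assumes U: "openin (Euclidean_space 4) U" "inj_on proj U"
  shows "homeomorphic_map (subtopology (mtop torus) (proj ` U)) (subtopology (Euclidean_space 4) U)
    (inv_into U proj)"
proof -
  have UR: "U \<subseteq> R4" using U openin_subset by blast
  have "homeomorphic_map (subtopology (Euclidean_space 4) U) (subtopology (mtop torus) (proj ` U)) proj"
  proof (rule bijective_open_imp_homeomorphic_map)
    show "continuous_map (subtopology (Euclidean_space 4) U) (subtopology (mtop torus) (proj ` U)) proj"
      by (intro continuous_map_into_subtopology continuous_map_from_subtopology continuous_map_proj) auto
    show "open_map (subtopology (Euclidean_space 4) U) (subtopology (mtop torus) (proj ` U)) proj"
      by (intro open_map_into_subtopology open_map_from_subtopology open_map_proj U) auto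
    show "proj ` topspace (subtopology (Euclidean_space 4) U) = topspace (subtopology (mtop torus) (proj ` U))"
      using UR by (auto simp: topspace_torus)
    show "inj_on proj (topspace (subtopology (Euclidean_space 4) U))"
      using U(2) by (rule inj_on_subset) auto
  qed
  then obtain g where g: "homeomorphic_maps (subtopology (Euclidean_space 4) U) (subtopology (mtop torus) (proj ` U)) proj g"
    unfolding homeomorphic_map_maps by blast
  then have "homeomorphic_map (subtopology (mtop torus) (proj ` U)) (subtopology (Euclidean_space 4) U) g"
    by (simp add: homeomorphic_maps_map)
  moreover have "g q = inv_into U proj q" if "q \<in> topspace (subtopology (mtop torus) (proj ` U))" for q
  proof -
    have "q \<in> proj ` U" using that by simp
    then obtain x where x: "x \<in> U" "q = proj x" by blast
    then have "g q = x" using g UR by (auto simp: homeomorphic_maps_map)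
    then show ?thesis using x U by simp
  qed
  ultimately show ?thesis by (rule homeomorphic_map_eq)
qed

lemma topological_manifold_torus: "topological_manifold torus"
  unfolding topological_manifold_def
proof (intro conjI ballI)
  show "\<Union> (fst ` atlas torus) = topspace (mtop torus)"
  proof (intro equalityI subsetI)
    fix q assume "q \<in> topspace (mtop torus)"
    then obtain x where x: "x \<in> R4" "q = proj x" by (auto simp: topspace_torus)
    obtain U where U: "openin (Euclidean_space 4) U" "inj_on proj U" "x \<in> U" using torus_chart_at[OF x(1)] .
    then have "(proj ` U, inv_into U proj) \<in> atlas torus" unfolding atlas_torus by blast
    moreover have "q \<in> fst (proj ` U, inv_into U proj)" using x U by simp
    ultimately show "q \<in> \<Union> (fst ` atlas torus)" by (meson UN_I)
  next
    fix q assume "q \<in> \<Union> (fst ` atlas torus)"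
    then obtain U where U: "openin (Euclidean_space 4) U" "q \<in> proj ` U" by (auto simp: atlas_torus)
    have "proj ` U \<subseteq> proj ` R4" by (intro image_mono openin_subset U)
    then show "q \<in> topspace (mtop torus)" using U(2) by (auto simp: topspace_torus)
  qed
next
  fix c assume "c \<in> atlas torus"
  then obtain U where U: "openin (Euclidean_space 4) U" "inj_on proj U" and c: "c = (proj ` U, inv_into U proj)"
    by (rule torus_chartE)
  have "inv_into U proj ` proj ` U = U" using U by simp
  moreover have "openin (mtop torus) (proj ` U)" using open_map_proj U(1) by (simp only: open_map_def)
  ultimately show "case c of (U, \<phi>) \<Rightarrow> openin (mtop torus) U \<and> openin (Euclidean_space (mdim torus)) (\<phi> ` U) \<and>
      homeomorphic_map (subtopology (mtop torus) U) (subtopology (Euclidean_space (mdim torus)) (\<phi> ` U)) \<phi>"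
    using torus_chart_homeomorphic[OF U] U by (simp add: c torus_simps(1) del: torus_simps(2))
next
  show "Hausdorff_space (mtop torus)" by (rule Hausdorff_torus)
  show "second_countable (mtop torus)" by (rule second_countable_torus)
qed

lemma int_lattice_discrete: "subtopology (Euclidean_space 4) int_lattice = discrete_topology int_lattice"
proof -
  have "openin (subtopology (Euclidean_space 4) int_lattice) {k}" if k: "k \<in> int_lattice" for k
  proof -
    have kR: "k \<in> R4" using k by (simp add: int_lattice_def)
    obtain U where U: "openin (Euclidean_space 4) U" "inj_on proj U" "k \<in> U"
      using torus_chart_at[OF kR] .
    have "l = k" if l: "l \<in> int_lattice" "l \<in> U" for l
    proof -
      have "l \<in> R4" using l by (simp add: int_lattice_def)
      moreover have "\<forall>i. k i - l i \<in> \<int>" using l k by (simp add: int_lattice_def)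
      ultimately have "proj l = proj k" using kR proj_eq_iff by blast
      then show ?thesis using inj_onD[OF U(2)] U(3) l(2) by blast
    qed
    then have "{k} = U \<inter> int_lattice" using U k by blast
    then show ?thesis using U by (auto simp: openin_subtopology)
  qed
  then have "discrete_topology int_lattice = subtopology (Euclidean_space 4) int_lattice"
    unfolding discrete_topology_unique by (simp add: int_lattice_def Int_absorb1 subset_iff)
  then show ?thesis by simp
qed

text \<open>
  Loops are contracted along straight lines.
\<close>

lemma simply_connected_Euclidean_space: "simply_connected_space (Euclidean_space n)"
  unfolding simply_connected_space_def
proof (intro conjI allI impI path_connected_Euclidean_space)
  fix p assume p: "pathin (Euclidean_space n) p \<and> p 0 = p 1"
  then have "continuous_map (top_of_set {0..1}) (top_of_set (topspace (Euclidean_space n))) p"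
    by (simp only: pathin_def Euclidean_space_eq[symmetric])
  then have cont: "continuous_on {0..1} p" and pin: "p \<in> {0..1} \<rightarrow> topspace (Euclidean_space n)"
    by simp_all
  have p0: "p 0 \<in> topspace (Euclidean_space n)" using pin by auto
  define h where "h = (\<lambda>(s::real, t::real) i. (1 - s) * p t i + s * p 0 i)"
  have "continuous_on ({0..1} \<times> {0..1}) h"
    unfolding h_def split_beta
    by (intro continuous_on_coordinatewise_then_product continuous_intros
        continuous_on_product_then_coordinatewise[OF continuous_on_compose2[OF cont]]) auto
  moreover have "h \<in> {0..1} \<times> {0..1} \<rightarrow> topspace (Euclidean_space n)"
    using pin p0 by (auto simp: h_def topspace_Euclidean_space Pi_iff)
  ultimately have "continuous_map (top_of_set ({0..1} \<times> {0..1})) (top_of_set (topspace (Euclidean_space n))) h"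
    by simp
  then have "continuous_map (prod_topology (top_of_set {0..1}) (top_of_set {0..1})) (Euclidean_space n) h"
    by (simp only: subtopology_Times prod_topology_euclidean[symmetric] Euclidean_space_eq[symmetric])
  then show "homotopic_with (\<lambda>q. q 0 = p 0 \<and> q 1 = p 0) (top_of_set {0..1}) (Euclidean_space n) p (\<lambda>_. p 0)"
    unfolding homotopic_with_def using p
    by (intro exI[of _ h]) (auto simp: h_def algebra_simps)
qed

lemma chart_inv_identity: "x \<in> S \<Longrightarrow> chart_inv (S, \<lambda>x. x) x = x"
  unfolding chart_inv_def by (simp add: inv_into_f_f[of "\<lambda>x. x", simplified])

lemma smooth_map_screw:
  assumes f: "f \<in> R4 \<rightarrow> R4" and g: "\<And>j. j < 4 \<Longrightarrow> g j \<in> elementary"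
    and fg: "\<And>x j. x \<in> R4 \<Longrightarrow> j < 4 \<Longrightarrow> f x j = g j x"
  shows "smooth_map screw_mfd screw_mfd f"
  unfolding smooth_map_def
proof (intro conjI ballI)
  have "continuous_map (Euclidean_space 4) (Euclidean_space 4) (\<lambda>x i. if i < 4 then g i x else 0)"
    unfolding continuous_map_componentwise_Euclidean_space continuous_map_Euclidean_space_iff
    using elementary_continuous g by blast
  moreover have "(\<lambda>i. if i < 4 then g i x else 0) = f x" if "x \<in> R4" for x
    using f fg that by (auto simp: topspace_Euclidean_space Pi_iff)
  ultimately show "continuous_map (mtop screw_mfd) (mtop screw_mfd) f"
    using continuous_map_eq by (simp, blast)
  fix c d assume "c \<in> atlas screw_mfd" "d \<in> atlas screw_mfd"
  moreover have "R4 \<inter> f -` R4 = R4" using f by auto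
  moreover have "smooth_on 4 4 R4 (\<lambda>x. f (chart_inv (R4, \<lambda>x. x) x))"
    using fg by (intro smooth_on_elementary[where g = g] g) (auto simp: chart_inv_identity)
  ultimately show "smooth_on (mdim screw_mfd) (mdim screw_mfd) (snd c ` (fst c \<inter> f -` fst d))
      (snd d \<circ> f \<circ> chart_inv c)"
    by (simp add: comp_def)
qed

lemma plane_rot_elementary:
  assumes "\<theta> \<in> elementary" "\<And>i. (\<lambda>x. u x i) \<in> elementary"
  shows "(\<lambda>x. plane_rot (\<theta> x) (u x) j) \<in> elementary"
proof -
  have [intro]: "(\<lambda>x. 2 * pi * \<theta> x) \<in> elementary"
    by (intro elementary.mult elementary.const assms)
  show ?thesis
    unfolding plane_rot_def by (cases "j = 0"; cases "j = 2") (auto intro!: elementary_intros assms)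
qed

lemma smooth_manifold_screw: "smooth_manifold screw_mfd"
proof -
  have "topological_manifold screw_mfd"
    unfolding topological_manifold_def
    by (auto simp: Hausdorff_Euclidean_space second_countable_Euclidean_space homeomorphic_map_id[unfolded id_def])
  moreover have "smooth_on 4 4 R4 (\<lambda>x. chart_inv (R4, \<lambda>x. x) x)"
    by (intro smooth_on_elementary[where g = "\<lambda>j x. x j"] elementary.coord) (auto simp: chart_inv_identity)
  ultimately show ?thesis unfolding smooth_manifold_def by (simp add: comp_def)
qed

lemma smooth_map_mult_screw:
  "smooth_map (prod_manifold screw_mfd screw_mfd) screw_mfd (\<lambda>(x, y). x \<otimes>\<^bsub>screw_group\<^esub> y)"
proof -
  let ?m = "\<lambda>(x, y). x \<otimes>\<^bsub>screw_group\<^esub> y" and ?E = "Euclidean_space 4"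
  have c1: "continuous_map (prod_topology ?E ?E) euclideanreal (\<lambda>z. fst z i)" for i
    using continuous_map_compose[OF continuous_map_fst[of ?E ?E], of euclideanreal "\<lambda>x. x i"]
      continuous_on_coordinate[of R4 i] by (simp add: comp_def continuous_map_Euclidean_space_iff)
  have c2: "continuous_map (prod_topology ?E ?E) euclideanreal (\<lambda>z. snd z i)" for i
    using continuous_map_compose[OF continuous_map_snd[of ?E ?E], of euclideanreal "\<lambda>x. x i"]
      continuous_on_coordinate[of R4 i] by (simp add: comp_def continuous_map_Euclidean_space_iff)
  have c3: "continuous_map (prod_topology ?E ?E) euclideanreal (\<lambda>z. h (2 * pi * fst z (Suc 0)))"
    if "continuous_on UNIV h" for h :: "real \<Rightarrow> real"
  proof -
    have "continuous_map (prod_topology ?E ?E) euclideanreal (\<lambda>z. 2 * pi * fst z (Suc 0))"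
      by (intro continuous_map_real_mult_left c1)
    from continuous_map_compose[OF this, of euclideanreal h] that show ?thesis
      by (simp add: comp_def)
  qed
  have "continuous_map (prod_topology ?E ?E) euclideanreal (\<lambda>z. ?m z i)" for i
    unfolding split_beta mult_screw plane_rot_def
    by (cases "i = 0"; cases "i = 2")
      (auto intro!: continuous_map_add continuous_map_diff continuous_map_real_mult c1 c2 c3 continuous_intros)
  then have "continuous_map (prod_topology ?E ?E) ?E (\<lambda>z i. if i < 4 then ?m z i else 0)"
    unfolding continuous_map_componentwise_Euclidean_space by blast
  then have cont: "continuous_map (prod_topology ?E ?E) ?E ?m"
  proof (rule continuous_map_eq)
    fix z assume "z \<in> topspace (prod_topology ?E ?E)"
    then have "?m z \<in> R4" by (auto intro: mult_screw_R4)
    then show "(\<lambda>i. if i < 4 then ?m z i else 0) = ?m z" by (auto simp: topspace_Euclidean_space)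
  qed
  let ?c = "(R4 \<times> R4, \<lambda>(p, q). join_coords 4 p q)"
  have atl: "atlas (prod_manifold screw_mfd screw_mfd) = {?c}"
    by (auto simp: prod_manifold_def)
  let ?p = "\<lambda>z i. if i < 4 then z i else 0 :: real" and ?q = "\<lambda>z i. z (i + 4) :: real"
  have inj: "inj_on (\<lambda>(p, q). join_coords 4 p q) (R4 \<times> R4)"
  proof (rule inj_onI, clarify)
    fix p q p' q' assume R: "p \<in> R4" "q \<in> R4" "p' \<in> R4" "q' \<in> R4" and eq: "join_coords 4 p q = join_coords 4 p' q'"
    have "p i = p' i" for i
      using R fun_cong[OF eq, of i] by (cases "i < 4") (auto simp: join_coords_def topspace_Euclidean_space)
    moreover have "q i = q' i" for i
      using fun_cong[OF eq, of "i + 4"] by (auto simp: join_coords_def)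
    ultimately show "p = p' \<and> q = q'" by blast
  qed
  have pq: "?p z \<in> R4" "?q z \<in> R4" "join_coords 4 (?p z) (?q z) = z"
    if "z \<in> topspace (Euclidean_space 8)" for z
    using that by (auto simp: join_coords_def topspace_Euclidean_space)
  have ci: "chart_inv ?c z = (?p z, ?q z)" if "z \<in> topspace (Euclidean_space 8)" for z
  proof -
    have "inv_into (R4 \<times> R4) (\<lambda>(p, q). join_coords 4 p q) ((\<lambda>(p, q). join_coords 4 p q) (?p z, ?q z)) = (?p z, ?q z)"
      by (rule inv_into_f_f[OF inj]) (use pq[OF that] in blast)
    then show ?thesis using pq(3)[OF that] by (simp add: chart_inv_def)
  qed
  have dom: "(\<lambda>(p, q). join_coords 4 p q) ` (R4 \<times> R4 \<inter> ?m -` R4) = topspace (Euclidean_space 8)"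
  proof (intro equalityI subsetI)
    fix z assume "z \<in> topspace (Euclidean_space 8)"
    then show "z \<in> (\<lambda>(p, q). join_coords 4 p q) ` (R4 \<times> R4 \<inter> ?m -` R4)"
      using pq[of z] by (intro image_eqI[of _ _ "(?p z, ?q z)"]) (auto intro: mult_screw_R4)
  qed (auto simp: join_coords_def topspace_Euclidean_space)
  have "smooth_on 8 4 (topspace (Euclidean_space 8)) (\<lambda>z. ?m (chart_inv ?c z))"
  proof (rule smooth_on_elementary[where g = "\<lambda>j z. ?p z j + plane_rot (z 1) (?q z) j"])
    show "(\<lambda>z. ?p z j + plane_rot (z 1) (?q z) j) \<in> elementary" for j
      by (cases "j < 4") (auto intro!: elementary.add elementary.coord elementary.const plane_rot_elementary)
  qed (auto simp: ci mult_screw)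
  then show ?thesis
    unfolding smooth_map_def atl using cont dom
    by (simp add: comp_def prod_manifold_def)
qed

lemma lie_group_screw: "lie_group screw_group screw_mfd"
proof -
  have "smooth_map screw_mfd screw_mfd (\<lambda>x. inv\<^bsub>screw_group\<^esub> x)"
  proof (rule smooth_map_screw)
    show "(\<lambda>x. inv\<^bsub>screw_group\<^esub> x) \<in> R4 \<rightarrow> R4"
      using group.inv_closed[OF group_screw] by auto
    show "(\<lambda>x. - plane_rot (- x 1) x j) \<in> elementary" for j
      by (intro elementary_uminus plane_rot_elementary elementary.coord)
  qed (simp add: inv_screw)
  then show ?thesis
    using group_screw smooth_manifold_screw smooth_map_mult_screw by (simp add: lie_group_def)
qed

section \<open>The Haar measure of the torus\<close>

text \<open>
  Lebesgue measure lives on Euclidean types, so the torus measure is transported from \<open>\<complex> \<times> \<complex>\<close>. The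
  first factor is the rotated plane, which makes right multiplication a shear.
\<close>

definition emb :: "complex \<times> complex \<Rightarrow> nat \<Rightarrow> real" where
  "emb v = (\<lambda>i. if i = 0 then Re (fst v) else if i = 1 then Re (snd v)
     else if i = 2 then Im (fst v) else if i = 3 then Im (snd v) else 0)"

definition unemb :: "(nat \<Rightarrow> real) \<Rightarrow> complex \<times> complex" where
  "unemb x = (Complex (x 0) (x 2), Complex (x 1) (x 3))"

lemma emb_R4 [simp]: "emb v \<in> R4"
  by (simp add: emb_def topspace_Euclidean_space)

lemma emb_add: "emb (u + v) = (\<lambda>i. emb u i + emb v i)"
  by (auto simp: emb_def)

lemma emb_unemb: "x \<in> R4 \<Longrightarrow> emb (unemb x) = x"
proof
  fix i :: nat assume x: "x \<in> R4"
  have "i = 0 \<or> i = 1 \<or> i = 2 \<or> i = 3 \<or> i \<ge> 4" by linarith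
  then show "emb (unemb x) i = x i"
    using x by (auto simp: emb_def unemb_def topspace_Euclidean_space)
qed

lemma emb_int_lattice:
  assumes "v \<in> integer_points"
  shows "emb v \<in> int_lattice"
proof -
  obtain z w where v: "v = (z, w)" by (cases v)
  have "Re z \<in> \<int>" "Im z \<in> \<int>" "Re w \<in> \<int>" "Im w \<in> \<int>"
    using assms unfolding v integer_points_def
    by (auto simp: Basis_prod_def Basis_complex_def)
  then have "emb v i \<in> \<int>" for i by (simp add: emb_def v)
  then show ?thesis by (simp add: int_lattice_def)
qed

lemma proj_emb_periodic: "k \<in> integer_points \<Longrightarrow> proj (emb (v + k)) = proj (emb v)"
  unfolding emb_add by (intro proj_add_int emb_R4 emb_int_lattice)

lemma continuous_emb: "continuous_on UNIV emb"
proof (rule continuous_on_coordinatewise_then_product)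
  fix i :: nat
  have "i = 0 \<or> i = 1 \<or> i = 2 \<or> i = 3 \<or> i \<ge> 4" by linarith
  then show "continuous_on UNIV (\<lambda>v. emb v i)"
    by (auto simp: emb_def intro!: continuous_intros)
qed

abbreviation torus_algebra :: "(nat \<Rightarrow> real) set measure" where
  "torus_algebra \<equiv> sigma (proj ` R4) {W. openin (mtop torus) W}"

definition torus_measure :: "(nat \<Rightarrow> real) set measure" where
  "torus_measure = distr (restrict_space lborel unit_cell) torus_algebra (\<lambda>v. proj (emb v))"

lemma open_sets_torus: "{W. openin (mtop torus) W} \<subseteq> Pow (proj ` R4)"
  using openin_subset[of "mtop torus"] unfolding topspace_torus by blast

lemma space_torus [simp]: "space torus_measure = proj ` R4"
  and sets_torus: "sets torus_measure = sigma_sets (proj ` R4) {W. openin (mtop torus) W}"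
  using open_sets_torus by (simp_all add: torus_measure_def)

lemma proj_emb_measurable: "(\<lambda>v. proj (emb v)) \<in> measurable borel torus_algebra"
proof (rule measurable_measure_of[OF open_sets_torus])
  fix W assume "W \<in> {W. openin (mtop torus) W}"
  then have "openin (Euclidean_space 4) {x \<in> R4. proj x \<in> W}" by (simp add: openin_torus)
  then obtain V where V: "open V" "{x \<in> R4. proj x \<in> W} = V \<inter> R4"
    unfolding openin_Euclidean_space_iff by blast
  have "proj (emb v) \<in> W \<longleftrightarrow> emb v \<in> V" for v
    using V(2) emb_R4[of v] by blast
  then have "(\<lambda>v. proj (emb v)) -` W = emb -` V" by (simp add: vimage_def)
  moreover have "open (emb -` V)"
    using V continuous_emb by (intro open_vimage) auto
  ultimately show "(\<lambda>v. proj (emb v)) -` W \<inter> space borel \<in> sets borel" by simp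
qed auto

lemma sets_lift_torus:
  assumes "E \<in> sets torus_measure"
  shows "{v. proj (emb v) \<in> E} \<in> sets borel"
proof -
  have "E \<in> sets torus_algebra" using assms by (simp add: torus_measure_def)
  from measurable_sets[OF proj_emb_measurable this] show ?thesis by (simp add: vimage_def)
qed

lemma emeasure_torus:
  assumes "E \<in> sets torus_measure"
  shows "emeasure torus_measure E = emeasure lborel (unit_cell \<inter> {v. proj (emb v) \<in> E})"
proof -
  have m: "(\<lambda>v. proj (emb v)) \<in> measurable (restrict_space lborel unit_cell) torus_algebra"
    by (intro measurable_restrict_space1) (use proj_emb_measurable in simp)
  have "E \<in> sets torus_algebra" using assms by (simp add: torus_measure_def)
  then have "emeasure torus_measure E =
      emeasure (restrict_space lborel unit_cell) ((\<lambda>v. proj (emb v)) -` E \<inter> unit_cell)"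
    unfolding torus_measure_def by (subst emeasure_distr[OF m]) (simp_all add: space_restrict_space)
  also have "\<dots> = emeasure lborel ((\<lambda>v. proj (emb v)) -` E \<inter> unit_cell)"
    by (rule emeasure_restrict_space) auto
  finally show ?thesis by (simp add: vimage_def Int_commute)
qed

lemma prob_space_torus: "prob_space torus_measure"
proof (rule prob_spaceI)
  have "{v. proj (emb v) \<in> proj ` R4} = UNIV" using emb_R4 by blast
  then show "emeasure torus_measure (space torus_measure) = 1"
    using emeasure_torus[OF sets.top] by (simp add: emeasure_unit_cell)
qed

lemma torus_continuous_map:
  assumes F: "continuous_map (Euclidean_space 4) (Euclidean_space 4) F"
    and f: "\<And>x. x \<in> R4 \<Longrightarrow> f (proj x) = proj (F x)"
  shows "continuous_map (mtop torus) (mtop torus) f"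
proof (rule continuous_compose_quotient_map[OF quotient_map_proj])
  have "continuous_map (Euclidean_space 4) (mtop torus) (proj \<circ> F)"
    by (rule continuous_map_compose[OF F continuous_map_proj])
  then show "continuous_map (Euclidean_space 4) (mtop torus) (f \<circ> proj)"
    by (rule continuous_map_eq) (simp add: f)
qed

text \<open>
  Measure preservation is checked on a lift of \<open>f\<close> to the covering space.
\<close>

lemma torus_preserves_measure:
  assumes f: "continuous_map (mtop torus) (mtop torus) f"
    and R: "R \<in> borel_measurable borel" "distr lborel borel R = lborel"
    and comm: "\<And>v k. k \<in> integer_points \<Longrightarrow> R (v + k) = R v + k"
    and fR: "\<And>v. f (proj (emb v)) = proj (emb (R v))"
  shows "preserves_measure torus_measure f"
proof -
  have fsp: "f \<in> proj ` R4 \<rightarrow> proj ` R4"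
    using continuous_map_image_subset_topspace[OF f] unfolding topspace_torus by blast
  have "f \<in> measurable torus_measure torus_algebra"
  proof (rule measurable_measure_of[OF open_sets_torus])
    fix W assume "W \<in> {W. openin (mtop torus) W}"
    then have "openin (mtop torus) {q \<in> topspace (mtop torus). f q \<in> W}"
      using f by (auto intro: openin_continuous_map_preimage)
    moreover have "f -` W \<inter> space torus_measure = {q \<in> topspace (mtop torus). f q \<in> W}"
      by (auto simp: topspace_torus)
    ultimately show "f -` W \<inter> space torus_measure \<in> sets torus_measure"
      unfolding sets_torus by (auto intro: sigma_sets.Basic)
  qed (use fsp in simp)
  then have meas: "f \<in> measurable torus_measure torus_measure"
    by (rule measurable_cong_sets[THEN equalityD1, THEN subsetD, rotated 2])
      (simp_all add: torus_measure_def)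
  moreover have "distr torus_measure torus_measure f = torus_measure"
  proof (rule measure_eqI)
    fix E assume "E \<in> sets (distr torus_measure torus_measure f)"
    then have E: "E \<in> sets torus_measure" by simp
    have "emeasure (distr torus_measure torus_measure f) E =
        emeasure torus_measure (f -` E \<inter> space torus_measure)"
      by (rule emeasure_distr[OF meas E])
    also have "\<dots> = emeasure lborel (unit_cell \<inter> {v. proj (emb v) \<in> f -` E \<inter> space torus_measure})"
      by (rule emeasure_torus[OF measurable_sets[OF meas E]])
    also have "{v. proj (emb v) \<in> f -` E \<inter> space torus_measure} = {v. R v \<in> {v. proj (emb v) \<in> E}}"
      by (auto simp: fR)
    also have "unit_cell \<inter> \<dots> = {v \<in> unit_cell. R v \<in> {v. proj (emb v) \<in> E}}" by blast
    also have "emeasure lborel \<dots> = emeasure lborel (unit_cell \<inter> {v. proj (emb v) \<in> E})"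
      by (rule emeasure_unit_cell_invariant[OF R comm sets_lift_torus[OF E]])
        (simp_all add: proj_emb_periodic)
    finally show "emeasure (distr torus_measure torus_measure f) E = emeasure torus_measure E"
      by (simp add: emeasure_torus[OF E])
  qed simp
  ultimately show ?thesis by (simp add: preserves_measure_def)
qed

text \<open>
  Right multiplication by \<open>g\<close> is not a translation of the torus, because the displacement in the
  plane is rotated by the angle of the point. It depends on the other factor only, so it is a shear.
\<close>

lemma right_mult_preserves:
  assumes g: "g \<in> R4"
  shows "preserves_measure torus_measure (\<lambda>q. q #>\<^bsub>screw_group\<^esub> g)"
proof -
  \<comment> \<open>the lift of the right multiplication to \<open>\<complex> \<times> \<complex>\<close>\<close>
  define R where "R = (\<lambda>(z, w). (z + cis (2 * pi * Re w) * fst (unemb g), w + snd (unemb g)))"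
  have proj_mult: "proj x #>\<^bsub>screw_group\<^esub> g = proj (x \<otimes>\<^bsub>screw_group\<^esub> g)" if "x \<in> R4" for x
    using that g by (intro group.coset_mult_assoc[OF group_screw]) (auto simp: int_lattice_def)
  have emb_R: "emb v \<otimes>\<^bsub>screw_group\<^esub> g = emb (R v)" for v
  proof
    fix i :: nat
    have "i = 0 \<or> i = 1 \<or> i = 2 \<or> i = 3 \<or> i \<ge> 4" by linarith
    then show "(emb v \<otimes>\<^bsub>screw_group\<^esub> g) i = emb (R v) i"
      using g by (auto simp: R_def emb_def unemb_def mult_screw plane_rot_def topspace_Euclidean_space split_beta)
  qed
  have "smooth_map screw_mfd screw_mfd (\<lambda>x. x \<otimes>\<^bsub>screw_group\<^esub> g)"
  proof (rule smooth_map_screw)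
    show "(\<lambda>x. x j + plane_rot (x 1) g j) \<in> elementary" for j
      by (intro elementary.add elementary.coord elementary.const plane_rot_elementary)
  qed (use g mult_screw_R4 in \<open>auto simp: mult_screw\<close>)
  then have "continuous_map (Euclidean_space 4) (Euclidean_space 4) (\<lambda>x. x \<otimes>\<^bsub>screw_group\<^esub> g)"
    by (simp add: smooth_map_def)
  then have cont: "continuous_map (mtop torus) (mtop torus) (\<lambda>q. q #>\<^bsub>screw_group\<^esub> g)"
    by (rule torus_continuous_map) (rule proj_mult)
  show ?thesis
  proof (rule torus_preserves_measure[OF cont])
    show "distr lborel borel R = lborel"
      unfolding R_def
      by (rule lborel_distr_shear) (intro borel_measurable_continuous_onI continuous_intros)
    show "R \<in> borel_measurable borel"
      unfolding R_def split_beta by (intro borel_measurable_continuous_onI continuous_intros)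
    show "proj (emb v) #>\<^bsub>screw_group\<^esub> g = proj (emb (R v))" for v
      by (simp add: proj_mult emb_R)
    show "R (v + k) = R v + k" if "k \<in> integer_points" for v k
    proof -
      have "snd k \<bullet> 1 \<in> \<int>"
        using that by (auto simp: integer_points_def Basis_prod_def Basis_complex_def inner_prod_def)
      then have "cis (2 * pi * Re (snd k)) = 1" by (auto elim!: Ints_cases)
      then have "cis (2 * pi * Re (snd v + snd k)) = cis (2 * pi * Re (snd v))"
        by (simp add: distrib_left flip: cis_mult)
      then show ?thesis by (simp add: R_def split_beta prod_eq_iff)
    qed
  qed
qed

lemma haar_measure_torus: "haar_measure screw_group screw_mfd int_lattice torus_measure"
  unfolding haar_measure_def rcosets_eq
  using prob_space_torus right_mult_preserves sets_torus by simp

lemma cocompact_lattice_int: "cocompact_lattice screw_group screw_mfd int_lattice"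
  unfolding cocompact_lattice_def lattice_subgroup_def
  using subgroup_int_lattice int_lattice_discrete haar_measure_torus compact_torus by auto

section \<open>Translations of the torus\<close>

definition torus_translation :: "(nat \<Rightarrow> real) \<Rightarrow> (nat \<Rightarrow> real) set \<Rightarrow> (nat \<Rightarrow> real) set" where
  "torus_translation a q = (\<lambda>x i. x i + a i) ` q"

lemma torus_translation_proj:
  assumes "a \<in> R4" "x \<in> R4"
  shows "torus_translation a (proj x) = proj (\<lambda>i. x i + a i)"
proof (intro equalityI subsetI)
  fix y assume "y \<in> proj (\<lambda>i. x i + a i)"
  then have y: "y \<in> R4" "\<And>i. y i - (x i + a i) \<in> \<int>" using assms by (auto simp: proj_eq topspace_Euclidean_closed)
  have "(\<lambda>i. y i - a i) \<in> proj x"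
    using y assms by (auto simp: proj_eq topspace_Euclidean_closed algebra_simps)
  then show "y \<in> torus_translation a (proj x)"
    unfolding torus_translation_def by (intro image_eqI[where x = "\<lambda>i. y i - a i"]) auto
qed (use assms in \<open>auto simp: torus_translation_def proj_eq topspace_Euclidean_closed\<close>)

lemma torus_translation_continuous:
  assumes "a \<in> R4"
  shows "continuous_map (mtop torus) (mtop torus) (torus_translation a)"
proof (rule torus_continuous_map)
  show "continuous_map (Euclidean_space 4) (Euclidean_space 4) (\<lambda>x i. x i + a i)"
    using assms by (intro continuous_map_Euclidean_space_add) auto
qed (rule torus_translation_proj[OF assms])

lemma torus_translation_preserves:
  assumes a: "a \<in> R4"
  shows "preserves_measure torus_measure (torus_translation a)"
proof (rule torus_preserves_measure[OF torus_translation_continuous[OF a]])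
  let ?R = "\<lambda>v. unemb a + v"
  show "distr lborel borel ?R = lborel" by (rule lborel_distr_plus)
  show "torus_translation a (proj (emb v)) = proj (emb (?R v))" for v
    using a by (simp add: torus_translation_proj emb_add emb_unemb add.commute)
qed (auto simp: add.assoc)

lemma torus_translation_funpow:
  assumes "a \<in> R4" "x \<in> R4"
  shows "(torus_translation a ^^ n) (proj x) = proj (\<lambda>i. x i + real n * a i)"
proof (induction n)
  case (Suc n)
  have "(\<lambda>i. x i + real n * a i) \<in> R4" using assms by (auto simp: topspace_Euclidean_space)
  then show ?case
    using Suc assms by (simp add: torus_translation_proj algebra_simps)
qed simp

text \<open>
  The lift of an invariant set is invariant under the lattice and under the integer multiples of
  \<open>a\<close>, which together are dense.
\<close>

lemma ergodic_torus_translation: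
  assumes a: "a \<in> R4"
    and dense: "\<And>x e. e > 0 \<Longrightarrow> \<exists>(k::int) (m :: nat \<Rightarrow> int). \<forall>i<4. \<bar>of_int k * a i - of_int (m i) - x i\<bar> < e"
  shows "ergodic torus_measure (torus_translation a)"
  unfolding ergodic_def
proof (intro conjI ballI impI torus_translation_preserves[OF a])
  fix E assume E: "E \<in> sets torus_measure"
    and inv: "torus_translation a -` E \<inter> space torus_measure = E"
  define L where "L = {v. proj (emb v) \<in> E}"
  define H where "H = {of_int k *\<^sub>R unemb a + l | k l. l \<in> integer_points}"
  have L: "L \<in> sets borel" unfolding L_def by (rule sets_lift_torus[OF E])
  have step: "v + unemb a \<in> L \<longleftrightarrow> v \<in> L" for v
  proof -
    have "proj (emb (v + unemb a)) = torus_translation a (proj (emb v))"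
      using a by (simp add: torus_translation_proj emb_add emb_unemb)
    moreover have "torus_translation a q \<in> E \<longleftrightarrow> q \<in> E" if "q \<in> proj ` R4" for q
      using inv that by (auto simp: set_eq_iff)
    ultimately show ?thesis by (simp add: L_def)
  qed
  have nat_step: "v + real n *\<^sub>R unemb a \<in> L \<longleftrightarrow> v \<in> L" for v n
  proof (induction n)
    case (Suc n)
    have "v + real (Suc n) *\<^sub>R unemb a = (v + real n *\<^sub>R unemb a) + unemb a"
      by (simp add: algebra_simps)
    then show ?case using step Suc by (simp only:)
  qed simp
  have int_step: "v + of_int k *\<^sub>R unemb a \<in> L \<longleftrightarrow> v \<in> L" for v and k :: int
  proof (cases k)
    case (nonneg n) then show ?thesis using nat_step by simp
  next
    case (neg n)
    have "(v + of_int k *\<^sub>R unemb a) + real (Suc n) *\<^sub>R unemb a = v"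
      unfolding neg by (simp add: algebra_simps)
    then show ?thesis using nat_step[of "v + of_int k *\<^sub>R unemb a" "Suc n"] by (simp only:)
  qed
  have "closure H = UNIV"
  proof (intro equalityI subset_UNIV subsetI)
    fix v :: "complex \<times> complex"
    show "v \<in> closure H" unfolding closure_approachable
    proof (intro allI impI)
      fix e :: real assume "e > 0"
      then obtain k :: int and m :: "nat \<Rightarrow> int"
        where km: "\<And>i. i < 4 \<Longrightarrow> \<bar>of_int k * a i - of_int (m i) - emb v i\<bar> < e / 4"
        using dense[of "e / 4" "emb v"] by auto
      define l where "l = - unemb (\<lambda>i. real_of_int (m i))"
      define d where "d = of_int k *\<^sub>R unemb a + l - v"
      have "l \<in> integer_points"
        by (auto simp: l_def unemb_def integer_points_def Basis_prod_def Basis_complex_def inner_prod_def inner_complex_def)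
      then have "of_int k *\<^sub>R unemb a + l \<in> H" unfolding H_def by blast
      moreover have "norm d < e"
      proof -
        have "\<bar>Re (fst d)\<bar> < e / 4" "\<bar>Re (snd d)\<bar> < e / 4" "\<bar>Im (fst d)\<bar> < e / 4" "\<bar>Im (snd d)\<bar> < e / 4"
          using km[of 0] km[of 1] km[of 2] km[of 3] by (simp_all add: d_def l_def unemb_def emb_def)
        moreover have "norm d \<le> norm (fst d) + norm (snd d)" using norm_Pair_le[of "fst d" "snd d"] by simp
        moreover have "norm (fst d) \<le> \<bar>Re (fst d)\<bar> + \<bar>Im (fst d)\<bar>" "norm (snd d) \<le> \<bar>Re (snd d)\<bar> + \<bar>Im (snd d)\<bar>"
          by (rule cmod_le)+
        ultimately show ?thesis by linarith
      qed
      ultimately show "\<exists>h\<in>H. dist h v < e" by (intro bexI[of _ "of_int k *\<^sub>R unemb a + l"]) (simp_all add: dist_norm d_def)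
    qed
  qed
  moreover have "v + h \<in> L \<longleftrightarrow> v \<in> L" if hH: "h \<in> H" for h v
  proof -
    obtain k l where h: "h = of_int k *\<^sub>R unemb a + l" "l \<in> integer_points" using hH unfolding H_def by blast
    have "v + h \<in> L \<longleftrightarrow> (v + of_int k *\<^sub>R unemb a) + l \<in> L" by (simp add: h add.assoc)
    also have "\<dots> \<longleftrightarrow> v + of_int k *\<^sub>R unemb a \<in> L" using proj_emb_periodic[OF h(2)] by (simp add: L_def)
    finally show ?thesis by (simp add: int_step)
  qed
  ultimately consider "emeasure lborel L = 0" | "emeasure lborel (- L) = 0"
    using dense_translations_ergodic[OF L] by blast
  then show "measure torus_measure E = 0 \<or> measure torus_measure E = 1"
  proof cases
    case 1
    have "emeasure torus_measure E \<le> emeasure lborel L"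
      unfolding emeasure_torus[OF E] L_def[symmetric] using L by (intro emeasure_mono) auto
    then show ?thesis using 1 by (simp add: measure_def)
  next
    case 2
    have "emeasure lborel (unit_cell - L) \<le> emeasure lborel (- L)"
      using L by (intro emeasure_mono) auto
    then have null: "unit_cell - L \<in> null_sets lborel" using 2 L by (auto simp: null_sets_def)
    have "emeasure lborel (unit_cell \<inter> L) = emeasure lborel ((unit_cell \<inter> L) \<union> (unit_cell - L))"
      using null L by (intro emeasure_Un_null_set[symmetric]) auto
    also have "(unit_cell \<inter> L) \<union> (unit_cell - L) = unit_cell" by blast
    finally show ?thesis
      using emeasure_torus[OF E] by (simp add: L_def[symmetric] emeasure_unit_cell measure_def)
  qed
qed

text \<open>
  When \<open>E\<close> is disjoint from its preimage under \<open>A\<^sup>k\<close>, the summand at \<open>k\<close> equals \<open>(m E)\<^sup>2\<close>. This happens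
  for at least one of any two consecutive \<open>k\<close>, so the averages over an even number of summands are
  at least \<open>(m E)\<^sup>2 / 2\<close>.
\<close>

lemma not_weakly_mixing_of_disjoint_returns:
  assumes E: "E \<in> sets m" and pos: "measure m E > 0"
    and disj: "\<And>k. (A ^^ k) -` E \<inter> E = {} \<or> (A ^^ Suc k) -` E \<inter> E = {}"
  shows "\<not> weakly_mixing m A"
proof
  assume "weakly_mixing m A"
  define c where "c = measure m E * measure m E"
  define t where "t k = \<bar>measure m ((A ^^ k) -` E \<inter> E) - c\<bar>" for k
  have lim: "(\<lambda>N. (\<Sum>k<N. t k) / real N) \<longlonglongrightarrow> 0"
    using \<open>weakly_mixing m A\<close> E unfolding weakly_mixing_def t_def c_def by blast
  have c: "c > 0" using pos by (simp add: c_def)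
  have pair: "c \<le> t k + t (Suc k)" for k
    using disj[of k]
  proof
    assume "(A ^^ k) -` E \<inter> E = {}"
    then have "t k = c" using c by (simp add: t_def)
    then show ?thesis by (simp add: t_def)
  next
    assume "(A ^^ Suc k) -` E \<inter> E = {}"
    then have "t (Suc k) = c" using c unfolding t_def by (metis abs_minus_cancel abs_of_pos diff_0 measure_empty)
    then show ?thesis by (simp add: t_def)
  qed
  have "real n * c \<le> (\<Sum>k<2 * n. t k)" for n
  proof (induction n)
    case (Suc n) then show ?case using pair[of "2 * n"] by (simp add: algebra_simps)
  qed simp
  then have "real (Suc n) * c / real (2 * Suc n) \<le> (\<Sum>k<2 * Suc n. t k) / real (2 * Suc n)" for n
    by (intro divide_right_mono) (simp_all only: of_nat_0_le_iff)
  moreover have "real (Suc n) * c / real (2 * Suc n) = c / 2" for n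
    by (simp add: field_simps)
  ultimately have "c / 2 \<le> (\<Sum>k<2 * Suc n. t k) / real (2 * Suc n)" for n
    by metis
  moreover have "(\<lambda>n. (\<Sum>k<2 * Suc n. t k) / real (2 * Suc n)) \<longlonglongrightarrow> 0"
    using LIMSEQ_subseq_LIMSEQ[OF lim, of "\<lambda>n. 2 * Suc n"] by (simp add: strict_mono_def comp_def)
  ultimately have "c / 2 \<le> 0" by (intro LIMSEQ_le_const) auto
  then show False using c by simp
qed

text \<open>
  If the strip of width \<open>1/8\<close> met its images after \<open>k\<close> and after \<open>k + 1\<close> steps, then \<open>a\<^sub>3\<close> would lie
  within \<open>1/4\<close> of an integer.
\<close>

lemma torus_translation_not_weakly_mixing:
  assumes a: "a \<in> R4" "1/4 < a 3" "a 3 < 3/4"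
  shows "\<not> weakly_mixing torus_measure (torus_translation a)"
proof -
  \<comment> \<open>open at both ends, so that its image is open and thus measurable\<close>
  define V where "V = {x \<in> R4. 0 < x 3 \<and> x 3 < 1/8}"
  have "open {x :: nat \<Rightarrow> real. 0 < x 3 \<and> x 3 < 1/8}"
    by (intro open_Collect_conj open_Collect_less continuous_intros continuous_on_coordinate)
  then have "openin (Euclidean_space 4) V"
    unfolding openin_Euclidean_space_iff V_def by (intro exI[of _ "{x. 0 < x 3 \<and> x 3 < 1/8}"]) auto
  then have "openin (mtop torus) (proj ` V)" using open_map_proj by (simp only: open_map_def)
  then have E: "proj ` V \<in> sets torus_measure" unfolding sets_torus by (intro sigma_sets.Basic) simp
  have "measure torus_measure (proj ` V) > 0"
  proof -
    define u :: "complex \<times> complex" where "u = (Complex 1 1, Complex 1 (1/8))"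
    have Bs: "Basis = {(1, 0), (\<i>, 0), (0, 1), (0, \<i>) :: complex \<times> complex}"
      by (auto simp: Basis_prod_def Basis_complex_def)
    have "box 0 u \<subseteq> unit_cell \<inter> {v. proj (emb v) \<in> proj ` V}"
    proof
      fix v assume "v \<in> box 0 u"
      then have v: "0 < Re (fst v)" "Re (fst v) < 1" "0 < Im (fst v)" "Im (fst v) < 1"
        "0 < Re (snd v)" "Re (snd v) < 1" "0 < Im (snd v)" "Im (snd v) < 1/8"
        by (auto simp: box_def Bs u_def inner_prod_def inner_complex_def)
      then have "v \<in> unit_cell"
        by (auto simp: unit_cell_def Bs inner_prod_def inner_complex_def)
      moreover have "emb v \<in> V" using v by (simp add: V_def emb_def[of v])  (use emb_R4[of v] in \<open>simp add: emb_def\<close>)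
      ultimately show "v \<in> unit_cell \<inter> {v. proj (emb v) \<in> proj ` V}" by blast
    qed
    then have "emeasure lborel (box 0 u) \<le> emeasure torus_measure (proj ` V)"
      unfolding emeasure_torus[OF E] using sets_lift_torus[OF E] by (intro emeasure_mono) auto
    moreover have "emeasure lborel (box 0 u) > 0"
      by (subst emeasure_lborel_box_eq) (auto simp: Bs u_def inner_prod_def inner_complex_def)
    ultimately have "emeasure torus_measure (proj ` V) > 0" by simp
    then show ?thesis
      using prob_space_torus finite_measure.emeasure_eq_measure prob_space.finite_measure
      by (metis ennreal_0 ennreal_less_zero_iff)
  qed
  moreover have "(torus_translation a ^^ k) -` (proj ` V) \<inter> proj ` V = {} \<or>
      (torus_translation a ^^ Suc k) -` (proj ` V) \<inter> proj ` V = {}" for k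
  proof (rule ccontr)
    have near: "\<exists>n::int. \<bar>real k * a 3 - n\<bar> < 1/8" if "(torus_translation a ^^ k) -` (proj ` V) \<inter> proj ` V \<noteq> {}" for k
    proof -
      obtain x y where xy: "x \<in> V" "y \<in> V" "(torus_translation a ^^ k) (proj x) = proj y"
        using \<open>_ \<noteq> {}\<close> by blast
      have R: "x \<in> R4" "y \<in> R4" "(\<lambda>i. x i + real k * a i) \<in> R4"
        using xy a by (auto simp: V_def topspace_Euclidean_space)
      have "proj (\<lambda>i. x i + real k * a i) = proj y"
        using torus_translation_funpow[OF a(1) R(1)] xy(3) by simp
      then have "y 3 - (x 3 + real k * a 3) \<in> \<int>" using proj_eq_iff[OF R(3,2)] by blast
      then obtain n where "y 3 - (x 3 + real k * a 3) = of_int n" by (auto elim: Ints_cases)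
      then have "real k * a 3 - of_int (- n) = y 3 - x 3" by simp
      moreover have "\<bar>y 3 - x 3\<bar> < 1/8" using xy(1,2) unfolding V_def abs_less_iff by simp
      ultimately show ?thesis by metis
    qed
    assume "\<not> ?thesis"
    then obtain n n' :: int where "\<bar>real k * a 3 - n\<bar> < 1/8" "\<bar>real (Suc k) * a 3 - n'\<bar> < 1/8"
      using near[of k] near[of "Suc k"] by blast
    moreover have "real (Suc k) * a 3 = real k * a 3 + a 3" by (simp add: algebra_simps)
    ultimately have "\<bar>a 3 - of_int (n' - n)\<bar> < 1/4"
      unfolding abs_less_iff of_int_diff by linarith
    then have "0 < n' - n" "n' - n < 1" using a(2,3) by linarith+
    then show False by simp
  qed
  ultimately show ?thesis by (rule not_weakly_mixing_of_disjoint_returns[OF E])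
qed

section \<open>Diffeomorphisms and affine automorphisms\<close>

lemma torus_smooth_map:
  assumes b: "b \<in> R4" and f: "\<And>x. x \<in> R4 \<Longrightarrow> f (proj x) = proj (\<lambda>i. x i + b i)"
  shows "smooth_map torus torus f"
  unfolding smooth_map_def
proof (intro conjI ballI)
  show "continuous_map (mtop torus) (mtop torus) f"
  proof (rule torus_continuous_map)
    show "continuous_map (Euclidean_space 4) (Euclidean_space 4) (\<lambda>x i. x i + b i)"
      using b by (intro continuous_map_Euclidean_space_add) auto
  qed (rule f)
  fix c d assume "c \<in> atlas torus" "d \<in> atlas torus"
  obtain U where U: "openin (Euclidean_space 4) U" "inj_on proj U" and c: "c = (proj ` U, inv_into U proj)"
    using \<open>c \<in> atlas torus\<close> by (rule torus_chartE)
  obtain V where V: "openin (Euclidean_space 4) V" "inj_on proj V" and d: "d = (proj ` V, inv_into V proj)"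
    using \<open>d \<in> atlas torus\<close> by (rule torus_chartE)
  from U V b f have "locally_translation 4 (inv_into U proj ` (proj ` U \<inter> f -` (proj ` V)))
      (inv_into V proj \<circ> f \<circ> chart_inv (proj ` U, inv_into U proj))"
    by (rule torus_transition)
  from locally_translation_smooth[OF this]
  show "smooth_on (mdim torus) (mdim torus) (snd c ` (fst c \<inter> f -` fst d)) (snd d \<circ> f \<circ> chart_inv c)"
    unfolding c d torus_simps(1) by simp
qed

lemma torus_diffeomorphism:
  assumes b: "b \<in> R4" and f: "\<And>x. x \<in> R4 \<Longrightarrow> f (proj x) = proj (\<lambda>i. x i + b i)"
  shows "diffeomorphism torus torus f"
proof -
  have nb: "(\<lambda>i. - b i) \<in> R4" by (rule topspace_Euclidean_closed(3)[OF b b])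
  have inj: "inj_on f (proj ` R4)"
  proof (intro inj_onI, clarify)
    fix x y assume xy: "x \<in> R4" "y \<in> R4" and "f (proj x) = f (proj y)"
    then have "proj (\<lambda>i. x i + b i) = proj (\<lambda>i. y i + b i)" by (simp add: f)
    from proj_add_cong[OF topspace_Euclidean_closed(1)[OF xy(1) b] topspace_Euclidean_closed(1)[OF xy(2) b] nb this]
    show "proj x = proj y" by simp
  qed
  have surj: "f (proj (\<lambda>i. x i - b i)) = proj x" if "x \<in> R4" for x
    using f[OF topspace_Euclidean_closed(2)[OF that b]] by simp
  have "f ` proj ` R4 = proj ` R4"
  proof (intro equalityI subsetI)
    fix q assume "q \<in> f ` proj ` R4"
    then obtain x where x: "x \<in> R4" "q = f (proj x)" by blast
    then show "q \<in> proj ` R4"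
      using topspace_Euclidean_closed(1)[OF x(1) b] f[OF x(1)] by simp
  next
    fix q assume "q \<in> proj ` R4"
    then obtain x where x: "x \<in> R4" "q = proj x" by blast
    have "f (proj (\<lambda>i. x i - b i)) \<in> f ` proj ` R4"
      by (intro imageI topspace_Euclidean_closed x b)
    then show "q \<in> f ` proj ` R4" using surj[OF x(1)] x(2) by simp
  qed
  then have "bij_betw f (topspace (mtop torus)) (topspace (mtop torus))"
    unfolding bij_betw_def topspace_torus using inj by simp
  moreover have "inv_into (proj ` R4) f (proj x) = proj (\<lambda>i. x i + - b i)" if x: "x \<in> R4" for x
  proof (rule inv_into_f_eq[OF inj])
    show "proj (\<lambda>i. x i + - b i) \<in> proj ` R4"
      using topspace_Euclidean_closed(1)[OF x nb] by simp
    show "f (proj (\<lambda>i. x i + - b i)) = proj x" using surj[OF x] by simp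
  qed
  then have "smooth_map torus torus (inv_into (topspace (mtop torus)) f)"
    unfolding topspace_torus by (rule torus_smooth_map[OF nb])
  ultimately show ?thesis
    unfolding diffeomorphism_def using torus_smooth_map[OF b f] by simp
qed

lemma plane_rot_automorphism: "lie_group_automorphism screw_group screw_mfd (plane_rot \<theta>)"
proof -
  have inv: "plane_rot (- \<eta>) (plane_rot \<eta> x) = x" for \<eta> x by (simp add: plane_rot_compose)
  have bij: "bij_betw (plane_rot \<theta>) R4 R4"
    by (rule bij_betw_byWitness[where f' = "plane_rot (- \<theta>)"])
      (use inv[of \<theta>] inv[of "- \<theta>"] plane_rot_R4 in auto)
  have "plane_rot \<theta> \<in> hom screw_group screw_group"
    by (intro homI) (simp_all add: plane_rot_R4 mult_screw plane_rot_add plane_rot_compose add.commute)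
  moreover have smooth: "smooth_map screw_mfd screw_mfd f"
    if "\<And>x. x \<in> R4 \<Longrightarrow> f x = plane_rot \<eta> x" for f \<eta>
  proof (rule smooth_map_screw)
    show "f \<in> R4 \<rightarrow> R4" using that plane_rot_R4 by simp
    show "(\<lambda>x. plane_rot \<eta> x j) \<in> elementary" for j
      by (intro plane_rot_elementary elementary.const elementary.coord)
  qed (simp add: that)
  have "inv_into R4 (plane_rot \<theta>) x = plane_rot (- \<theta>) x" if "x \<in> R4" for x
    using bij_betw_imp_inj_on[OF bij] plane_rot_R4[OF that] inv[of "- \<theta>" x]
    by (intro inv_into_f_eq) simp_all
  then have "smooth_map screw_mfd screw_mfd (inv_into R4 (plane_rot \<theta>))" by (rule smooth)
  ultimately show ?thesis
    using bij smooth[of "plane_rot \<theta>" \<theta>]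
    by (simp add: lie_group_automorphism_def iso_def diffeomorphism_def)
qed

text \<open>
  The rotation of the plane caused by left multiplication by \<open>a\<close> is cancelled by taking the opposite
  rotation as linear part. The conjugation by \<open>a\<close> then fixes each lattice point, because left
  multiplication by a lattice point is translation, too.
\<close>

lemma affine_torus_translation:
  assumes a: "a \<in> R4"
  shows "affine_automorphism screw_group screw_mfd int_lattice (torus_translation a)"
proof -
  interpret group screw_group by (rule group_screw)
  let ?\<Phi> = "plane_rot (- a 1)"
  have lin: "a \<otimes>\<^bsub>screw_group\<^esub> ?\<Phi> x = (\<lambda>i. x i + a i)" for x
    by (simp add: mult_screw plane_rot_compose add.commute)
  have "a \<otimes>\<^bsub>screw_group\<^esub> ?\<Phi> k \<otimes>\<^bsub>screw_group\<^esub> inv\<^bsub>screw_group\<^esub> a = k"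
    if k: "k \<in> int_lattice" for k
  proof -
    have "a \<otimes>\<^bsub>screw_group\<^esub> ?\<Phi> k = k \<otimes>\<^bsub>screw_group\<^esub> a"
      unfolding lin using k by (simp add: mult_screw plane_rot_Ints int_lattice_def)
    moreover have "k \<in> carrier screw_group" "a \<in> carrier screw_group"
      using a k by (simp_all add: int_lattice_def)
    ultimately show ?thesis by (metis m_assoc r_inv r_one inv_closed)
  qed
  then have "(\<lambda>k. a \<otimes>\<^bsub>screw_group\<^esub> ?\<Phi> k \<otimes>\<^bsub>screw_group\<^esub> inv\<^bsub>screw_group\<^esub> a) ` int_lattice = int_lattice"
    by simp
  moreover have "\<forall>g\<in>R4. torus_translation a (proj g) = proj (a \<otimes>\<^bsub>screw_group\<^esub> ?\<Phi> g)"
    unfolding lin using torus_translation_proj[OF a] by blast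
  moreover have "diffeomorphism torus torus (torus_translation a)"
    by (rule torus_diffeomorphism[OF a torus_translation_proj[OF a]])
  ultimately show ?thesis
    unfolding affine_automorphism_def using plane_rot_automorphism a carrier_screw by metis
qed

section \<open>Tangent vectors of the torus\<close>

lemma charts_at_torus_nonempty:
  assumes "p \<in> proj ` R4"
  shows "charts_at torus p \<noteq> {}"
proof -
  obtain x where x: "x \<in> R4" "p = proj x" using assms by blast
  obtain U where U: "openin (Euclidean_space 4) U" "inj_on proj U" "x \<in> U" using torus_chart_at[OF x(1)] .
  then have "(proj ` U, inv_into U proj) \<in> charts_at torus p"
    unfolding charts_at_def atlas_torus using x by auto
  then show ?thesis by blast
qed

lemma torus_jacobian:
  assumes b: "b \<in> R4" and f: "\<And>x. x \<in> R4 \<Longrightarrow> f (proj x) = proj (\<lambda>i. x i + b i)"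
    and c: "c \<in> charts_at torus p" and d: "d \<in> charts_at torus (f p)" and u: "u \<in> R4"
  shows "jacobian_map 4 (snd d \<circ> f \<circ> chart_inv c) (snd c p) u = u"
proof -
  have "c \<in> atlas torus" "d \<in> atlas torus" using c d by (simp_all add: charts_at_def)
  obtain U where U: "openin (Euclidean_space 4) U" "inj_on proj U" and c': "c = (proj ` U, inv_into U proj)"
    using \<open>c \<in> atlas torus\<close> by (rule torus_chartE)
  obtain V where V: "openin (Euclidean_space 4) V" "inj_on proj V" and d': "d = (proj ` V, inv_into V proj)"
    using \<open>d \<in> atlas torus\<close> by (rule torus_chartE)
  from U V b f have "locally_translation 4 (inv_into U proj ` (proj ` U \<inter> f -` (proj ` V)))
      (inv_into V proj \<circ> f \<circ> chart_inv (proj ` U, inv_into U proj))"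
    by (rule torus_transition)
  moreover have "p \<in> proj ` U \<inter> f -` (proj ` V)" using c d by (simp add: charts_at_def c' d')
  ultimately show ?thesis
    unfolding c' d' fst_conv snd_conv using u by (rule locally_translation_jacobian[OF _ imageI])
qed

lemma torus_jacobian_id:
  assumes "c \<in> charts_at torus p" "d \<in> charts_at torus p" "u \<in> R4"
  shows "jacobian_map 4 (snd d \<circ> chart_inv c) (snd c p) u = u"
  using torus_jacobian[of "\<lambda>_. 0" "\<lambda>p. p" c p d u] assms by (simp add: comp_def)

text \<open>
  All transition Jacobians are the identity, so a tangent vector has the same coordinates in all
  charts.
\<close>

lemma tangent_space_torus:
  "tangent_space torus p = {v. (\<forall>c\<in>charts_at torus p. v c \<in> R4) \<and>
     (\<forall>c\<in>charts_at torus p. \<forall>d\<in>charts_at torus p. v d = v c) \<and>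
     (\<forall>c. c \<notin> charts_at torus p \<longrightarrow> v c = (\<lambda>_. 0))}"
  unfolding tangent_space_def torus_simps(1)
  by (intro Collect_cong conj_cong refl ball_cong) (simp add: torus_jacobian_id)

lemma tangent_space_torusD:
  assumes "v \<in> tangent_space torus p"
  shows "c \<in> charts_at torus p \<Longrightarrow> v c \<in> R4"
    and "c \<in> charts_at torus p \<Longrightarrow> d \<in> charts_at torus p \<Longrightarrow> v d = v c"
    and "c \<notin> charts_at torus p \<Longrightarrow> v c = (\<lambda>_. 0)"
proof -
  have "(\<forall>c\<in>charts_at torus p. v c \<in> R4) \<and>
     (\<forall>c\<in>charts_at torus p. \<forall>d\<in>charts_at torus p. v d = v c) \<and>
     (\<forall>c. c \<notin> charts_at torus p \<longrightarrow> v c = (\<lambda>_. 0))"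
    using assms unfolding tangent_space_torus by (rule CollectD)
  then show "c \<in> charts_at torus p \<Longrightarrow> v c \<in> R4"
    and "c \<in> charts_at torus p \<Longrightarrow> d \<in> charts_at torus p \<Longrightarrow> v d = v c"
    and "c \<notin> charts_at torus p \<Longrightarrow> v c = (\<lambda>_. 0)"
    by (fast, metis, fast)
qed

lemma tangent_map_torus:
  assumes b: "b \<in> R4" and f: "\<And>x. x \<in> R4 \<Longrightarrow> f (proj x) = proj (\<lambda>i. x i + b i)"
    and v: "v \<in> tangent_space torus p" and c: "c \<in> charts_at torus p"
  shows "tangent_map torus torus f p v = (\<lambda>d. if d \<in> charts_at torus (f p) then v c else (\<lambda>_. 0))"
proof
  fix d
  define c' where "c' = (SOME c. c \<in> charts_at torus p)"
  have c': "c' \<in> charts_at torus p" unfolding c'_def using c by (rule someI)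
  have "v c' = v c" "v c' \<in> R4"
    using tangent_space_torusD(2)[OF v c c'] tangent_space_torusD(1)[OF v c'] .
  then show "tangent_map torus torus f p v d = (if d \<in> charts_at torus (f p) then v c else (\<lambda>_. 0))"
    unfolding tangent_map_def Let_def c'_def[symmetric] torus_simps(1)
    using torus_jacobian[OF b f c', of d "v c'"] by simp
qed

section \<open>The complex structure\<close>

lemma mult_i_eq: "mult_i x = (\<lambda>i. if even i then - x (Suc i) else x (i - 1))"
  by (auto simp: mult_i_def realify_def complexify_def)

lemma mult_i_R4: "x \<in> R4 \<Longrightarrow> mult_i x \<in> R4"
  unfolding topspace_Euclidean_space mult_i_eq
proof (clarify, goal_cases)
  case (1 i)
  show ?case
  proof (cases "even i")
    case True then show ?thesis using 1 by simp
  next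
    case False
    then have "i \<noteq> 4" by auto
    then have "i - 1 \<ge> 4" using 1(2) by simp
    then show ?thesis using 1 False by simp
  qed
qed

lemma mult_i_zero: "mult_i (\<lambda>_. 0) = (\<lambda>_. 0)"
  by (auto simp: mult_i_eq)

lemma mult_i_mult_i: "mult_i (mult_i x) = (\<lambda>i. - x i)"
  by (auto simp: mult_i_eq)

text \<open>
  Constant in the flat charts. The formula needs no case distinction off the charts at \<open>p\<close>, where
  tangent vectors vanish, because \<^const>\<open>mult_i\<close> is linear.
\<close>

definition torus_J :: "(nat \<Rightarrow> real) set \<Rightarrow> (nat \<Rightarrow> real) set tvec \<Rightarrow> (nat \<Rightarrow> real) set tvec" where
  "torus_J p v = (\<lambda>c. mult_i (v c))"

lemma torus_J_tangent: "v \<in> tangent_space torus p \<Longrightarrow> torus_J p v \<in> tangent_space torus p"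
proof -
  assume v: "v \<in> tangent_space torus p"
  show ?thesis
    unfolding tangent_space_torus torus_J_def
  proof (intro CollectI conjI ballI allI impI)
    show "mult_i (v c) \<in> R4" if "c \<in> charts_at torus p" for c
      using tangent_space_torusD(1)[OF v that] by (rule mult_i_R4)
    show "mult_i (v d) = mult_i (v c)" if "c \<in> charts_at torus p" "d \<in> charts_at torus p" for c d
      using tangent_space_torusD(2)[OF v that] by (rule arg_cong)
    show "mult_i (v c) = (\<lambda>_. 0)" if "c \<notin> charts_at torus p" for c
      unfolding tangent_space_torusD(3)[OF v that] by (rule mult_i_zero)
  qed
qed

lemma smooth_bundle_endo_torus_J: "smooth_bundle_endo torus torus_J"
  unfolding smooth_bundle_endo_def
proof (intro conjI ballI allI impI)
  fix p show "linear_endo (tangent_space torus p) (torus_J p)"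
    unfolding linear_endo_def
  proof (intro conjI ballI allI)
    fix v w a b
    show "torus_J p (lin_comb a v b w) = lin_comb a (torus_J p v) b (torus_J p w)"
      by (intro ext) (simp add: torus_J_def lin_comb_def mult_i_eq)
  qed (rule torus_J_tangent)
next
  fix c and i j :: nat assume c: "c \<in> atlas torus" and "j < mdim torus"
  then have j: "j < 4" by (simp add: torus_simps(1))
  obtain U where U: "openin (Euclidean_space 4) U" "inj_on proj U" and c': "c = (proj ` U, inv_into U proj)"
    using c by (rule torus_chartE)
  let ?e = "\<lambda>i. if i = j then 1 else 0 :: real"
  have e: "?e \<in> R4" using j by (auto simp: topspace_Euclidean_space)
  have const: "torus_J (chart_inv c x) (coord_field torus c j (chart_inv c x)) c i = mult_i ?e i" if x: "x \<in> U" for x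
  proof -
    have p: "chart_inv c x = proj x" unfolding c' by (rule chart_inv_torus[OF U(2) x])
    have "c \<in> charts_at torus (proj x)" using c x by (simp add: charts_at_def c')
    then show ?thesis
      unfolding p torus_J_def coord_field_def tvec_of_coords_def torus_simps(1)
      using torus_jacobian_id[OF _ _ e] by simp
  qed
  have "snd c ` fst c = U" unfolding c' using U(2) by simp
  moreover have "smooth_fun_on 4 U (\<lambda>x. torus_J (chart_inv c x) (coord_field torus c j (chart_inv c x)) c i)"
  proof (rule smooth_fun_on_locally_elementary)
    show "U \<subseteq> R4" using U(1) by (rule openin_subset)
    fix x assume "x \<in> U"
    then show "\<exists>V g. openin (Euclidean_space 4) V \<and> x \<in> V \<and> g \<in> elementary \<and>
        (\<forall>y\<in>V. torus_J (chart_inv c y) (coord_field torus c j (chart_inv c y)) c i = g y)"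
      using U(1) const by (intro exI[of _ U] exI[of _ "\<lambda>_. mult_i ?e i"]) (simp add: elementary.const)
  qed
  ultimately show "smooth_fun_on (mdim torus) (snd c ` fst c)
      (\<lambda>x. torus_J (chart_inv c x) (coord_field torus c j (chart_inv c x)) c i)"
    by (simp add: torus_simps(1))
qed

lemma realify_complexify: "realify (complexify x) = x"
proof
  fix i show "realify (complexify x) i = x i"
    by (cases "even i") (auto simp: realify_def complexify_def)
qed

lemma complexify_realify: "complexify (realify z) = z"
  by (auto simp: realify_def complexify_def complex_eq_iff)

lemma continuous_realify: "continuous_on S realify"
proof (rule continuous_on_coordinatewise_then_product)
  have "continuous_on S (\<lambda>z. z k :: complex)" for k
    by (rule continuous_on_subset[OF continuous_on_product_coordinates]) simp
  then show "continuous_on S (\<lambda>z. realify z i)" for i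
    unfolding realify_def by (cases "even i") (auto intro!: continuous_intros)
qed

text \<open>
  A translation of \<open>\<real>\<^sup>2\<^sup>n\<close> is one of \<open>\<complex>\<^sup>n\<close>, and varying a single complex coordinate moves two real
  ones, so the local description has to be used on a full neighbourhood.
\<close>

lemma holomorphic_of_locally_translation:
  assumes F: "locally_translation (2 * n) D F"
    and G: "\<And>x. x \<in> D \<Longrightarrow> G (complexify x) = complexify (F x)"
  shows "holomorphic_map_on n m (complexify ` D) G"
  unfolding holomorphic_map_on_def
proof (intro allI impI conjI)
  fix j
  let ?E = "Euclidean_space (2 * n)"
  have loc: "\<exists>W C. open W \<and> realify z \<in> W \<and>
      (\<forall>z'. realify z' \<in> W \<inter> topspace ?E \<longrightarrow> G z' j = z' j + C)" if z: "z \<in> complexify ` D" for z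
  proof -
    have x: "realify z \<in> D" using z by (auto simp: realify_complexify)
    with F obtain V c where V: "openin ?E V" "realify z \<in> V" "V \<subseteq> D"
      and c: "\<forall>y\<in>V. F y = (\<lambda>i. y i + c i)" by (rule locally_translationE)
    obtain W where W: "open W" "V = W \<inter> topspace ?E"
      using V(1) unfolding openin_Euclidean_space_iff by blast
    have "G z' j = z' j + complexify c j" if z': "realify z' \<in> V" for z'
    proof -
      have "G z' = complexify (F (realify z'))"
        using G[of "realify z'"] z' V(3) by (auto simp: complexify_realify)
      also have "F (realify z') = (\<lambda>i. realify z' i + c i)" using c z' by (rule bspec)
      finally have "G z' j = complexify (realify z') j + complexify c j"
        by (simp add: complexify_def complex_eq_iff)
      then show ?thesis by (simp add: complexify_realify)
    qed
    then show ?thesis using W V(2) by (intro exI[of _ W] exI[of _ "complexify c j"]) simp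
  qed
  have DE: "D \<subseteq> topspace ?E" using F by (rule locally_translation_subset)
  show "continuous_on (complexify ` D) (\<lambda>z. G z j)"
    unfolding continuous_on_def
  proof
    fix z assume z: "z \<in> complexify ` D"
    then obtain W C where W: "open W" "realify z \<in> W"
      and GC: "\<forall>z'. realify z' \<in> W \<inter> topspace ?E \<longrightarrow> G z' j = z' j + C" using loc by metis
    have ev: "\<forall>\<^sub>F z' in at z within complexify ` D. z' j + C = G z' j"
      unfolding eventually_at_topological
    proof (intro exI[of _ "realify -` W"] conjI ballI impI)
      show "open (realify -` W)" using W(1) continuous_realify by (rule open_vimage)
      fix z' assume "z' \<in> realify -` W" "z' \<in> complexify ` D"
      moreover from this have "realify z' \<in> topspace ?E" using DE by (auto simp: realify_complexify)
      ultimately show "z' j + C = G z' j" using GC by simp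
    qed (use W in simp)
    have "continuous_on (complexify ` D) (\<lambda>z. z j + C)"
      by (intro continuous_intros continuous_on_subset[OF continuous_on_product_coordinates]) simp
    then have "((\<lambda>z'. z' j + C) \<longlongrightarrow> z j + C) (at z within complexify ` D)"
      using z unfolding continuous_on_def by (rule bspec)
    then have "((\<lambda>z. G z j) \<longlongrightarrow> z j + C) (at z within complexify ` D)"
      using ev by (rule Lim_transform_eventually)
    moreover have "realify z \<in> topspace ?E" using z DE by (auto simp: realify_complexify)
    then have "G z j = z j + C" using GC W(2) by simp
    ultimately show "((\<lambda>z. G z j) \<longlongrightarrow> G z j) (at z within complexify ` D)" by simp
  qed
  show "\<forall>z\<in>complexify ` D. \<forall>i<n. (\<lambda>t. G (z(i := t)) j) field_differentiable at (z i)"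
  proof (intro ballI allI impI)
    fix z i assume z: "z \<in> complexify ` D" and i: "i < n"
    then obtain W C where W: "open W" "realify z \<in> W"
      and GC: "\<forall>z'. realify z' \<in> W \<inter> topspace ?E \<longrightarrow> G z' j = z' j + C" using loc by metis
    have zE: "realify z \<in> topspace ?E" using z DE by (auto simp: realify_complexify)
    have upd: "realify (z(i := t)) \<in> topspace ?E" for t
      using zE i by (auto simp: topspace_Euclidean_space realify_def)
    have "continuous_on UNIV (\<lambda>t. z(i := t))"
    proof (rule continuous_on_coordinatewise_then_product)
      show "continuous_on UNIV (\<lambda>t. (z(i := t)) k)" for k by (cases "k = i") auto
    qed
    then have "continuous_on UNIV (\<lambda>t. realify (z(i := t)))"
      by (rule continuous_on_compose2[OF continuous_realify]) auto
    with W(1) have "open ((\<lambda>t. realify (z(i := t))) -` W)" by (rule open_vimage)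
    then have "\<forall>\<^sub>F t in nhds (z i). t \<in> (\<lambda>t. realify (z(i := t))) -` W"
      using W(2) by (intro eventually_nhds_in_open) simp_all
    then have "\<forall>\<^sub>F t in nhds (z i). G (z(i := t)) j = (z(i := t)) j + C"
      by eventually_elim (use GC upd in simp)
    then have "((\<lambda>t. G (z(i := t)) j) has_field_derivative (if j = i then 1 else 0)) (at (z i)) \<longleftrightarrow>
        ((\<lambda>t. (z(i := t)) j + C) has_field_derivative (if j = i then 1 else 0)) (at (z i))"
      by (intro DERIV_cong_ev refl)
    moreover have "((\<lambda>t. (z(i := t)) j + C) has_field_derivative (if j = i then 1 else 0)) (at (z i))"
      by (cases "j = i") (auto intro!: derivative_eq_intros)
    ultimately show "(\<lambda>t. G (z(i := t)) j) field_differentiable at (z i)"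
      unfolding field_differentiable_def by blast
  qed
qed

text \<open>
  Its underlying real atlas is the given one, so the diffeomorphism in the definition of integrability
  is the identity of one and the same manifold.
\<close>

definition torus_complex_atlas ::
  "((nat \<Rightarrow> real) set set \<times> ((nat \<Rightarrow> real) set \<Rightarrow> nat \<Rightarrow> complex)) set" where
  "torus_complex_atlas = (\<lambda>(V, \<phi>). (V, complexify \<circ> \<phi>)) ` atlas torus"

lemma underlying_torus: "underlying_manifold (mtop torus) 2 torus_complex_atlas = torus"
proof -
  have "(\<lambda>(V, \<psi>). (V, realify \<circ> \<psi>)) ` torus_complex_atlas = (\<lambda>c. c) ` atlas torus"
    unfolding torus_complex_atlas_def image_image
    by (intro image_cong refl) (auto simp: comp_def realify_complexify)
  then show ?thesis by (simp add: underlying_manifold_def quotient_manifold_def)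
qed

lemma complex_manifold_torus: "complex_manifold (mtop torus) 2 torus_complex_atlas"
  unfolding complex_manifold_def underlying_torus
proof
  have key: "holomorphic_map_on 2 2 (\<psi> ` (V' \<inter> W')) (\<eta> \<circ> inv_into V' \<psi>)"
    if VW: "(V', \<psi>) \<in> torus_complex_atlas" "(W', \<eta>) \<in> torus_complex_atlas" for V' \<psi> W' \<eta>
  proof -
    obtain c where cd1: "c \<in> atlas torus" "V' = fst c" "\<psi> = complexify \<circ> snd c"
      using VW(1) unfolding torus_complex_atlas_def by (auto simp: split_beta)
    obtain d where cd2: "d \<in> atlas torus" "W' = fst d" "\<eta> = complexify \<circ> snd d"
      using VW(2) unfolding torus_complex_atlas_def by (auto simp: split_beta)
    obtain U where U: "openin (Euclidean_space 4) U" "inj_on proj U" and c: "c = (proj ` U, inv_into U proj)"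
      using cd1(1) by (rule torus_chartE)
    obtain V where V: "openin (Euclidean_space 4) V" "inj_on proj V" and d: "d = (proj ` V, inv_into V proj)"
      using cd2(1) by (rule torus_chartE)
    let ?D = "inv_into U proj ` (proj ` U \<inter> proj ` V)"
    let ?\<psi> = "complexify \<circ> inv_into U proj" and ?\<eta> = "complexify \<circ> inv_into V proj"
    have "locally_translation 4 (inv_into U proj ` (proj ` U \<inter> (\<lambda>p. p) -` (proj ` V)))
        (inv_into V proj \<circ> (\<lambda>p. p) \<circ> chart_inv (proj ` U, inv_into U proj))"
      by (rule torus_transition[OF U V zero_R4]) simp
    then have loc: "locally_translation (2 * 2) ?D (inv_into V proj \<circ> chart_inv (proj ` U, inv_into U proj))"
      by (simp add: comp_def)
    have "holomorphic_map_on 2 2 (complexify ` ?D) (?\<eta> \<circ> inv_into (proj ` U) ?\<psi>)"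
    proof (rule holomorphic_of_locally_translation[OF loc])
      fix x assume "x \<in> ?D"
      then obtain p where p: "p \<in> proj ` U" "x = inv_into U proj p" by blast
      have inj: "inj_on (inv_into U proj) (proj ` U)" by (rule inj_on_inv_into) simp
      have "inj complexify" by (rule inj_on_inverseI[where g = realify]) (rule realify_complexify)
      then have "inj_on ?\<psi> (proj ` U)" using inj by (intro comp_inj_on) (auto intro: inj_on_subset)
      then have "inv_into (proj ` U) ?\<psi> (?\<psi> p) = p" using p(1) by (rule inv_into_f_f)
      moreover have "chart_inv (proj ` U, inv_into U proj) x = p"
        unfolding chart_inv_def p(2) using inj p(1) by simp
      ultimately show "(?\<eta> \<circ> inv_into (proj ` U) ?\<psi>) (complexify x) =
          complexify ((inv_into V proj \<circ> chart_inv (proj ` U, inv_into U proj)) x)"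
        using p(2) by simp
    qed
    then show ?thesis by (simp add: cd1 cd2 c d image_comp)
  qed
  then show "\<forall>(V, \<psi>)\<in>torus_complex_atlas. \<forall>(W, \<eta>)\<in>torus_complex_atlas.
      holomorphic_map_on 2 2 (\<psi> ` (V \<inter> W)) (\<eta> \<circ> inv_into V \<psi>)"
    by (auto split: prod.split)
qed (rule topological_manifold_torus)

lemma complex_structure_torus_J: "complex_structure torus torus_J"
  unfolding complex_structure_def
proof (intro conjI ballI smooth_bundle_endo_torus_J)
  show "torus_J p (torus_J p v) = (\<lambda>c i. - v c i)" for p v
    by (simp add: torus_J_def mult_i_mult_i)
  show "integrable_structure torus torus_J"
    unfolding integrable_structure_def
  proof (intro exI[of _ 2] exI[of _ torus_complex_atlas] conjI ballI complex_manifold_torus;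
      unfold underlying_torus topspace_torus)
    show "diffeomorphism torus torus (\<lambda>p. p)"
      by (rule torus_diffeomorphism[OF zero_R4]) simp
    fix p v assume p: "p \<in> proj ` R4" and v: "v \<in> tangent_space torus p"
    obtain c where c: "c \<in> charts_at torus p" using charts_at_torus_nonempty[OF p] by blast
    have id: "(proj x :: (nat \<Rightarrow> real) set) = proj (\<lambda>i. x i + 0)" for x by simp
    show "tangent_map torus torus (\<lambda>p. p) p (torus_J p v) =
        (\<lambda>d. mult_i (tangent_map torus torus (\<lambda>p. p) p v d))"
      unfolding tangent_map_torus[of _ "\<lambda>p. p", OF zero_R4 id v c]
        tangent_map_torus[of _ "\<lambda>p. p", OF zero_R4 id torus_J_tangent[OF v] c]
      by (auto simp: torus_J_def mult_i_zero)
  qed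
qed

lemma torus_J_invariant:
  assumes a: "a \<in> R4"
  shows "torus_J \<in> invariant_complex_structures torus (torus_translation a)"
  unfolding invariant_complex_structures_def
proof (intro CollectI conjI ballI complex_structure_torus_J)
  fix p v assume p: "p \<in> topspace (mtop torus)" and v: "v \<in> tangent_space torus p"
  obtain c where c: "c \<in> charts_at torus p"
    using charts_at_torus_nonempty p unfolding topspace_torus by blast
  have dA: "tangent_map torus torus (torus_translation a) p w =
      (\<lambda>d. if d \<in> charts_at torus (torus_translation a p) then w c else (\<lambda>_. 0))"
    if "w \<in> tangent_space torus p" for w
    using a torus_translation_proj[OF a] that c by (rule tangent_map_torus)
  show "tangent_map torus torus (torus_translation a) p (torus_J p v) =
      torus_J (torus_translation a p) (tangent_map torus torus (torus_translation a) p v)"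
    unfolding dA[OF v] dA[OF torus_J_tangent[OF v]] by (auto simp: torus_J_def mult_i_zero)
qed

section \<open>Left-invariance\<close>

lemma jacobian_left_mult:
  assumes x: "x \<in> R4" and u: "u \<in> R4" and F: "\<And>y. y \<in> R4 \<Longrightarrow> F y = g \<otimes>\<^bsub>screw_group\<^esub> y"
  shows "jacobian_map 4 F x u = plane_rot (g 1) u"
proof
  fix i
  let ?e = "\<lambda>j k. if k = j then 1 else 0 :: real"
  have "partial_deriv j (\<lambda>y. F y i) x = plane_rot (g 1) (?e j) i" if j: "j < 4" for j
  proof -
    have "partial_deriv j (\<lambda>y. F y i) x = partial_deriv j (\<lambda>y. g i + plane_rot (g 1) y i) x"
      by (rule partial_deriv_cong[of 4 R4]) (use x j in \<open>simp_all add: F mult_screw\<close>)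
    also have "\<dots> = plane_rot (g 1) (?e j) i"
      unfolding partial_deriv_def
    proof (rule DERIV_imp_deriv)
      define C where "C = g i + plane_rot (g 1) (x(j := 0)) i"
      have lin: "(\<lambda>t. g i + plane_rot (g 1) (x(j := t)) i) = (\<lambda>t. C + plane_rot (g 1) (?e j) i * t)"
        unfolding C_def plane_rot_def by (rule ext) (simp add: algebra_simps)
      show "((\<lambda>t. g i + plane_rot (g 1) (x(j := t)) i) has_real_derivative
          plane_rot (g 1) (?e j) i) (at (x j))"
        unfolding lin by (auto intro!: derivative_eq_intros)
    qed
    finally show ?thesis .
  qed
  then have "jacobian_map 4 F x u i = (\<Sum>j<4. plane_rot (g 1) (?e j) i * u j)"
    unfolding jacobian_map_def by (intro sum.cong) auto
  also have "\<dots> = plane_rot (g 1) u i"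
  proof -
    have "i = 0 \<or> i = 1 \<or> i = 2 \<or> i = 3 \<or> i \<ge> 4" by linarith
    then show ?thesis
      using u by (auto simp: plane_rot_def topspace_Euclidean_space eval_nat_numeral)
  qed
  finally show "jacobian_map 4 F x u i = plane_rot (g 1) u i" .
qed

lemma charts_at_screw: "x \<in> R4 \<Longrightarrow> charts_at screw_mfd x = {(R4, \<lambda>x. x)}"
  by (auto simp: charts_at_def)

text \<open>
  The left-invariant frame, seen in flat coordinates, is rotated by the angle of the base point.
\<close>

lemma descended_field_coords:
  assumes g: "g \<in> R4" and v: "v (R4, \<lambda>x. x) \<in> R4" and d: "d \<in> charts_at torus (proj g)"
  shows "descended_field screw_group screw_mfd int_lattice v g d = plane_rot (g 1) (v (R4, \<lambda>x. x))"
proof -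
  let ?c = "(R4, \<lambda>x. x) :: (nat \<Rightarrow> real) chart"
  have some: "(SOME c. c \<in> charts_at screw_mfd x) = ?c" if "x \<in> R4" for x
    unfolding charts_at_screw[OF that] by simp
  have mult: "g \<otimes>\<^bsub>screw_group\<^esub> (\<lambda>_. 0) = g" by (simp add: mult_screw)
  have "left_invariant_field screw_group screw_mfd v g ?c =
      jacobian_map 4 (\<lambda>x. g \<otimes>\<^bsub>screw_group\<^esub> chart_inv ?c x) (\<lambda>_. 0) (v ?c)"
    unfolding left_invariant_field_def tangent_map_def Let_def one_screw some[OF zero_R4] mult
      charts_at_screw[OF g] by (simp add: comp_def)
  also have "\<dots> = plane_rot (g 1) (v ?c)"
    by (rule jacobian_left_mult[OF zero_R4 v]) (simp add: chart_inv_identity)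
  finally have lif: "left_invariant_field screw_group screw_mfd v g ?c = plane_rot (g 1) (v ?c)" .
  have "d \<in> atlas torus" using d by (simp add: charts_at_def)
  then obtain V where V: "openin (Euclidean_space 4) V" "inj_on proj V" and d': "d = (proj ` V, inv_into V proj)"
    by (rule torus_chartE)
  have "proj (\<lambda>i. g i + 0) \<in> proj ` V" using d by (simp add: charts_at_def d')
  with V zero_R4 g obtain N c where N: "openin (Euclidean_space 4) N" "g \<in> N"
    and sec: "\<forall>y\<in>N. proj (\<lambda>i. y i + 0) \<in> proj ` V \<and>
      inv_into V proj (proj (\<lambda>i. y i + 0)) = (\<lambda>i. y i + c i)"
    by (rule local_section_translation)
  have "N \<subseteq> R4" using N(1) by (rule openin_subset)
  then have "\<forall>y\<in>N. (snd d \<circ> proj \<circ> chart_inv ?c) y = (\<lambda>i. y i + c i)"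
    using sec by (auto simp: d' chart_inv_identity)
  then have jac: "jacobian_map 4 (snd d \<circ> proj \<circ> chart_inv ?c) g (plane_rot (g 1) (v ?c)) = plane_rot (g 1) (v ?c)"
    by (rule jacobian_map_translation[OF N _ plane_rot_R4[OF v]])
  show ?thesis
    unfolding descended_field_def tangent_map_def[of screw_mfd torus] Let_def some[OF g] lif
    using d jac by simp
qed

text \<open>
  At the identity the endomorphism \<open>j\<close> of the Lie algebra would have to be multiplication by \<open>\<i>\<close>, and at a
  point with angle \<open>1/4\<close> it would have to be its conjugate by a quarter turn. These differ on the
  first basis vector.
\<close>

lemma torus_J_not_left_invariant: "\<not> left_invariant_structure screw_group screw_mfd int_lattice torus_J"
proof
  assume "left_invariant_structure screw_group screw_mfd int_lattice torus_J"
  then obtain j where j: "linear_endo (tangent_space screw_mfd (\<lambda>_. 0)) j"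
    and J: "\<And>g v. g \<in> R4 \<Longrightarrow> v \<in> tangent_space screw_mfd (\<lambda>_. 0) \<Longrightarrow>
      torus_J (proj g) (descended_field screw_group screw_mfd int_lattice v g) =
      descended_field screw_group screw_mfd int_lattice (j v) g"
    unfolding left_invariant_structure_def by auto
  let ?c = "(R4, \<lambda>x. x) :: (nat \<Rightarrow> real) chart"
  define e where "e = (\<lambda>i::nat. if i = 0 then 1 else 0 :: real)"
  define v where "v = (\<lambda>c. if c = ?c then e else (\<lambda>_. 0))"
  have e: "e \<in> R4" by (simp add: e_def topspace_Euclidean_space)
  have "jacobian_map 4 (\<lambda>x. chart_inv ?c x) (\<lambda>_. 0) e = e"
    using jacobian_left_mult[OF zero_R4 e, of "chart_inv ?c" "\<lambda>_. 0"]
    by (simp add: chart_inv_identity mult_screw)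
  then have v: "v \<in> tangent_space screw_mfd (\<lambda>_. 0)"
    unfolding tangent_space_def charts_at_screw[OF zero_R4]
    using e by (simp add: v_def comp_def)
  then have "j v \<in> tangent_space screw_mfd (\<lambda>_. 0)" using j by (simp add: linear_endo_def)
  then have jv: "j v ?c \<in> R4"
    unfolding tangent_space_def charts_at_screw[OF zero_R4] by simp
  have rel: "mult_i (plane_rot (g 1) e) = plane_rot (g 1) (j v ?c)" if g: "g \<in> R4" for g
  proof -
    obtain d where d: "d \<in> charts_at torus (proj g)" using charts_at_torus_nonempty g by blast
    have "mult_i (descended_field screw_group screw_mfd int_lattice v g d) =
        descended_field screw_group screw_mfd int_lattice (j v) g d"
      using J[OF g v] unfolding torus_J_def by (rule fun_cong)
    then show ?thesis
      using descended_field_coords[of g v, OF g _ d] descended_field_coords[of g "j v", OF g jv d] e by (simp add: v_def)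
  qed
  have j0: "j v ?c = mult_i e" using rel[OF zero_R4] by simp
  define g where "g = (\<lambda>i::nat. if i = 1 then 1 / 4 else 0 :: real)"
  have g: "g \<in> R4" by (simp add: g_def topspace_Euclidean_space)
  have angle: "2 * pi * g 1 = pi / 2" by (simp add: g_def)
  have "plane_rot (g 1) u = (\<lambda>i. if i = 0 then - u 2 else if i = 2 then u 0 else u i)" for u
    unfolding plane_rot_def angle by auto
  then have "mult_i (plane_rot (g 1) e) 1 \<noteq> plane_rot (g 1) (mult_i e) 1"
    by (simp add: mult_i_eq e_def)
  then show False using rel[OF g] j0 by simp
qed

theorem mainTheorem3:
  shows "\<exists>(G :: (nat \<Rightarrow> real) monoid) (M :: (nat \<Rightarrow> real) mfd) \<Gamma> A m.
    lie_group G M \<and> simply_connected_space (mtop M) \<and> cocompact_lattice G M \<Gamma> \<and>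
    affine_automorphism G M \<Gamma> A \<and> haar_measure G M \<Gamma> m \<and>
    ergodic m A \<and> \<not> weakly_mixing m A \<and>
    (\<exists>J \<in> invariant_complex_structures (quotient_manifold G M \<Gamma>) A.
       \<not> left_invariant_structure G M \<Gamma> J)"
proof -
  obtain a0 :: "nat \<Rightarrow> real" where a0: "1/4 < a0 (4 - 1)" "a0 (4 - 1) < 3/4"
    and dense0: "\<And>x e. e > 0 \<Longrightarrow>
      \<exists>(k::int) (m :: nat \<Rightarrow> int). \<forall>i<4. \<bar>of_int k * a0 i - of_int (m i) - x i\<bar> < e"
    using equidistributing_vector[of 4] by auto
  define a where "a = (\<lambda>i. if i < 4 then a0 i else 0)"
  have a: "a \<in> R4" by (simp add: a_def topspace_Euclidean_space)
  have dense: "\<exists>(k::int) (m :: nat \<Rightarrow> int). \<forall>i<4. \<bar>of_int k * a i - of_int (m i) - x i\<bar> < e" if "e > 0" for x e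
    using dense0[OF that, of x] by (simp add: a_def)
  have "simply_connected_space (mtop screw_mfd)"
    using simply_connected_Euclidean_space by simp
  moreover have "ergodic torus_measure (torus_translation a)"
    by (rule ergodic_torus_translation[OF a dense])
  moreover have "\<not> weakly_mixing torus_measure (torus_translation a)"
    using a a0 by (intro torus_translation_not_weakly_mixing) (simp_all add: a_def)
  moreover have "\<exists>J \<in> invariant_complex_structures torus (torus_translation a).
      \<not> left_invariant_structure screw_group screw_mfd int_lattice J"
    using torus_J_invariant[OF a] torus_J_not_left_invariant by blast
  ultimately show ?thesis
    using lie_group_screw cocompact_lattice_int affine_torus_translation[OF a] haar_measure_torus
    by (intro exI[of _ screw_group] exI[of _ screw_mfd] exI[of _ int_lattice]
        exI[of _ "torus_translation a"] exI[of _ torus_measure] conjI)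
qed

end
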